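(* Let $\mathbf{a}$ and $\mathbf{b}=\{b_j:j\ge1\}$ be infinite disjoint subsets of $\mathbb{D}$ satisfying the Blaschke condition. Suppose that $P_{\mathcal{K}_{\mathbf{b}}}P_{\mathcal{Z}^0_{\mathbf{a}}}$ is compact. Then: 1. $B_{\mathbf{a}}(b_j)\to0$ as $j\to\infty$; 2. $\lim\mathbf{b}\subset\lim\mathbf{a}$.
   Context: $H^2$ is the Hardy space of the unit disk $\mathbb{D}$. A set $\mathbf{a}=\{a_k:k\ge1\}\subset\mathbb{D}$ satisfies the Blaschke condition if $\sum_k(1-|a_k|)<\infty$; $B_{\mathbf{a}}=\prod_k b_{a_k}$ is the Blaschke product with simple zeros $\mathbf{a}$, where $b_0(z)=z$ and $b_{a}(z)=\frac{\bar a}{|a|}\frac{a-z}{1-\bar az}$ for $a\neq0$. $\mathcal{K}_{\mathbf{a}}=H^2\ominus B_{\mathbf{a}}H^2$ and similarly $\mathcal{K}_{\mathbf{b}}$, $\mathcal{K}_{\mathbf{a}\cup\mathbf{b}}$. $\mathcal{H}_0=\mathcal{K}_{\mathbf{a}\cup\mathbf{b}}$ and $\mathcal{Z}^0_{\mathbf{a}}=\mathcal{H}_0\ominus\mathcal{K}_{\mathbf{a}}$. $P_{\mathcal{S}}$ is the orthogonal projection onto $\mathcal{S}$. $\lim\mathbf{a}=\overline{\mathbf{a}}\setminus\mathbf{a}\subset\mathbb{T}$ is the limit set. *)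

theory Defs
  imports "HOL-Complex_Analysis.Complex_Analysis"
begin

section \<open>The Hardy space of the unit disk\<close>

definition taylor_coeff :: "(complex \<Rightarrow> complex) \<Rightarrow> nat \<Rightarrow> complex" where
  "taylor_coeff f n = (deriv ^^ n) f 0 / fact n"

text \<open>Elements of the Hardy space are total functions that vanish off the open unit disk, so that
  equality of elements is equality of HOL functions.\<close>

definition hardy2 :: "(complex \<Rightarrow> complex) set" where
  "hardy2 = {f. f holomorphic_on ball 0 1 \<and> (\<forall>z. z \<notin> ball 0 1 \<longrightarrow> f z = 0) \<and>
                summable (\<lambda>n. (cmod (taylor_coeff f n))\<^sup>2)}"

definition hardy2_inner :: "(complex \<Rightarrow> complex) \<Rightarrow> (complex \<Rightarrow> complex) \<Rightarrow> complex" where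
  "hardy2_inner f g = (\<Sum>n. taylor_coeff f n * cnj (taylor_coeff g n))"

definition hardy2_norm :: "(complex \<Rightarrow> complex) \<Rightarrow> real" where
  "hardy2_norm f = sqrt (Re (hardy2_inner f f))"

definition hardy2_ominus ::
    "(complex \<Rightarrow> complex) set \<Rightarrow> (complex \<Rightarrow> complex) set \<Rightarrow> (complex \<Rightarrow> complex) set" where
  "hardy2_ominus S T = {f \<in> S. \<forall>g\<in>T. hardy2_inner f g = 0}"

text \<open>The orthogonal projection of \<open>f\<close> onto \<open>S\<close>; meaningful for \<open>f\<close> in \<open>hardy2\<close> and \<open>S\<close> a closed
  linear subspace of \<open>hardy2\<close>.\<close>

definition hardy2_proj ::
    "(complex \<Rightarrow> complex) set \<Rightarrow> (complex \<Rightarrow> complex) \<Rightarrow> (complex \<Rightarrow> complex)" where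
  "hardy2_proj S f = (THE g. g \<in> S \<and> (\<forall>h\<in>S. hardy2_inner (\<lambda>z. f z - g z) h = 0))"

text \<open>Compactness of a linear map from \<open>hardy2\<close> to itself: the images of a bounded sequence have a
  norm-convergent subsequence. Linearity is not part of the definition.\<close>

definition hardy2_compact_operator ::
    "((complex \<Rightarrow> complex) \<Rightarrow> (complex \<Rightarrow> complex)) \<Rightarrow> bool" where
  "hardy2_compact_operator T \<longleftrightarrow>
     (\<forall>f :: nat \<Rightarrow> complex \<Rightarrow> complex.
        (\<forall>n. f n \<in> hardy2) \<and> (\<exists>C. \<forall>n. hardy2_norm (f n) \<le> C) \<longrightarrow>
        (\<exists>r g. strict_mono r \<and> g \<in> hardy2 \<and>
           (\<lambda>n. hardy2_norm (\<lambda>z. T (f (r n)) z - g z)) \<longlonglongrightarrow> 0))"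

section \<open>Blaschke products and model spaces\<close>

definition blaschke_condition :: "complex set \<Rightarrow> bool" where
  "blaschke_condition A \<longleftrightarrow> A \<subseteq> ball 0 1 \<and> (\<lambda>a. 1 - cmod a) summable_on A"

definition blaschke_factor :: "complex \<Rightarrow> complex \<Rightarrow> complex" where
  "blaschke_factor a z =
     (if a = 0 then z else cnj a / complex_of_real (cmod a) * ((a - z) / (1 - cnj a * z)))"

text \<open>The unordered product over \<open>A\<close>, in the sense in which \<^const>\<open>infsum\<close> is the unordered sum;
  under the Blaschke condition it converges at every point of the disk.\<close>

definition blaschke_product :: "complex set \<Rightarrow> complex \<Rightarrow> complex" where
  "blaschke_product A z = Lim (finite_subsets_at_top A) (\<lambda>F. \<Prod>a\<in>F. blaschke_factor a z)"

definition model_space :: "complex set \<Rightarrow> (complex \<Rightarrow> complex) set" where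
  "model_space A =
     hardy2_ominus hardy2 ((\<lambda>h z. blaschke_product A z * h z) ` hardy2)"

definition zero_space :: "complex set \<Rightarrow> complex set \<Rightarrow> (complex \<Rightarrow> complex) set" where
  "zero_space A B = hardy2_ominus (model_space (A \<union> B)) (model_space A)"

definition limit_set :: "complex set \<Rightarrow> complex set" where
  "limit_set A = closure A - A"

end

theory Submission
  imports Defs
begin

text \<open>Let \<open>\<theta>\<close> be the Blaschke product of \<open>A\<close> and \<open>x\<^sub>j\<close> the normalized reproducing kernel at \<open>b\<^sub>j\<close>. Since
  \<open>x\<^sub>j\<close> lies in \<open>K\<^sub>B\<close>, and hence in \<open>K\<^bsub>A \<union> B\<^esub>\<close>, its projection \<open>u\<^sub>j\<close> to the zero space is \<open>x\<^sub>j\<close> minus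
  its projection to \<open>K\<^sub>A\<close>, and \<open>\<langle>P\<^sub>B u\<^sub>j, x\<^sub>j\<rangle> = \<langle>u\<^sub>j, x\<^sub>j\<rangle> = \<parallel>u\<^sub>j\<parallel>\<^sup>2\<close>. Testing \<open>u\<^sub>j\<close> against \<open>\<theta> x\<^sub>j\<close>, whose norm
  is at most one, gives \<open>\<bar>\<theta>(b\<^sub>j)\<bar> \<le> \<parallel>u\<^sub>j\<parallel>\<close>. The \<open>x\<^sub>j\<close> tend weakly to zero, so compactness forces
  \<open>\<theta>(b\<^sub>j) \<rightarrow> 0\<close>. Only the contractivity of multiplication by \<open>\<theta>\<close> is needed, not that \<open>\<theta>\<close> is inner.

  For the limit sets, if \<open>z\<close> keeps a distance \<open>d\<close> from \<open>A\<close> then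
  \<open>1 - \<bar>\<theta>(z)\<bar>\<^sup>2 \<le> (1 - \<bar>z\<bar>\<^sup>2) (2 / d\<^sup>2) (\<Sum>a\<in>A. 1 - \<bar>a\<bar>)\<close>, so \<open>\<bar>\<theta>\<bar>\<close> tends to one at every point of the
  circle outside the closure of \<open>A\<close>.\<close>

section \<open>The Hardy space as a Hilbert space\<close>

text \<open>The finite Cauchy-Schwarz inequality bounds every partial sum by the product of the full
  l2 norms. As the terms are nonnegative, this one bound yields both the convergence and the
  estimate.\<close>

lemma l2_mult_summable:
  fixes a b :: "nat \<Rightarrow> complex"
  assumes a: "summable (\<lambda>n. (cmod (a n))\<^sup>2)" and b: "summable (\<lambda>n. (cmod (b n))\<^sup>2)"
  shows "summable (\<lambda>n. cmod (a n) * cmod (b n))"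
    and "(\<Sum>n. cmod (a n) * cmod (b n)) \<le> sqrt (\<Sum>n. (cmod (a n))\<^sup>2) * sqrt (\<Sum>n. (cmod (b n))\<^sup>2)"
proof -
  have partial: "(\<Sum>i<n. cmod (a i) * cmod (b i))
      \<le> sqrt (\<Sum>n. (cmod (a n))\<^sup>2) * sqrt (\<Sum>n. (cmod (b n))\<^sup>2)" for n
  proof -
    have "(\<Sum>i<n. cmod (a i) * cmod (b i)) \<le> L2_set (\<lambda>i. cmod (a i)) {..<n} * L2_set (\<lambda>i. cmod (b i)) {..<n}"
      using L2_set_mult_ineq[of "\<lambda>i. cmod (a i)" "\<lambda>i. cmod (b i)" "{..<n}"] by simp
    also have "\<dots> \<le> sqrt (\<Sum>n. (cmod (a n))\<^sup>2) * sqrt (\<Sum>n. (cmod (b n))\<^sup>2)"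
      unfolding L2_set_def
      by (intro mult_mono real_sqrt_le_mono sum_le_suminf a b real_sqrt_ge_zero suminf_nonneg sum_nonneg) auto
    finally show ?thesis .
  qed
  show s: "summable (\<lambda>n. cmod (a n) * cmod (b n))"
    by (rule summableI_nonneg_bounded[OF _ partial]) auto
  show "(\<Sum>n. cmod (a n) * cmod (b n)) \<le> sqrt (\<Sum>n. (cmod (a n))\<^sup>2) * sqrt (\<Sum>n. (cmod (b n))\<^sup>2)"
    by (rule suminf_le_const[OF s partial])
qed

section \<open>Taylor coefficients and the vector space structure\<close>

lemma taylor_coeff_add:
  "\<lbrakk>f holomorphic_on ball 0 1; g holomorphic_on ball 0 1\<rbrakk>
    \<Longrightarrow> taylor_coeff (\<lambda>z. f z + g z) n = taylor_coeff f n + taylor_coeff g n"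
  by (simp add: taylor_coeff_def higher_deriv_add[of f "ball 0 1" g 0 n] add_divide_distrib)

lemma taylor_coeff_diff:
  "\<lbrakk>f holomorphic_on ball 0 1; g holomorphic_on ball 0 1\<rbrakk>
    \<Longrightarrow> taylor_coeff (\<lambda>z. f z - g z) n = taylor_coeff f n - taylor_coeff g n"
  by (simp add: taylor_coeff_def higher_deriv_diff[of f "ball 0 1" g 0 n] diff_divide_distrib)

lemma taylor_coeff_cmult:
  "f holomorphic_on ball 0 1 \<Longrightarrow> taylor_coeff (\<lambda>z. c * f z) n = c * taylor_coeff f n"
  by (simp add: taylor_coeff_def higher_deriv_cmult[of f "ball 0 1" 0 n c])

lemma taylor_coeff_sums:
  assumes "f holomorphic_on ball 0 1" "cmod z < 1"
  shows "(\<lambda>n. taylor_coeff f n * z ^ n) sums f z"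
  using holomorphic_power_series[OF assms(1), of z] assms(2) by (simp add: taylor_coeff_def)

lemma hardy2_holomorphic: "f \<in> hardy2 \<Longrightarrow> f holomorphic_on ball 0 1"
  and hardy2_off_disk: "\<lbrakk>f \<in> hardy2; z \<notin> ball 0 1\<rbrakk> \<Longrightarrow> f z = 0"
  and hardy2_summable: "f \<in> hardy2 \<Longrightarrow> summable (\<lambda>n. (cmod (taylor_coeff f n))\<^sup>2)"
  by (auto simp: hardy2_def)

lemma summable_power2_add:
  fixes a b :: "nat \<Rightarrow> complex"
  assumes a: "summable (\<lambda>n. (cmod (a n))\<^sup>2)" and b: "summable (\<lambda>n. (cmod (b n))\<^sup>2)"
  shows "summable (\<lambda>n. (cmod (a n + b n))\<^sup>2)"
proof (rule summable_comparison_test_ev)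
  show "summable (\<lambda>n. 2 * (cmod (a n))\<^sup>2 + 2 * (cmod (b n))\<^sup>2)"
    by (intro summable_add summable_mult a b)
  show "\<forall>\<^sub>F n in sequentially. norm ((cmod (a n + b n))\<^sup>2) \<le> 2 * (cmod (a n))\<^sup>2 + 2 * (cmod (b n))\<^sup>2"
  proof (intro always_eventually allI)
    fix n
    have "(cmod (a n + b n))\<^sup>2 \<le> (cmod (a n) + cmod (b n))\<^sup>2"
      by (intro power_mono norm_triangle_ineq) auto
    also have "\<dots> \<le> 2 * (cmod (a n))\<^sup>2 + 2 * (cmod (b n))\<^sup>2"
      using sum_squares_bound[of "cmod (a n)" "cmod (b n)"] by (simp add: power2_sum)
    finally show "norm ((cmod (a n + b n))\<^sup>2) \<le> 2 * (cmod (a n))\<^sup>2 + 2 * (cmod (b n))\<^sup>2"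
      by simp
  qed
qed

lemma hardy2_cmult: "f \<in> hardy2 \<Longrightarrow> (\<lambda>z. c * f z) \<in> hardy2"
  by (auto simp: hardy2_def taylor_coeff_cmult norm_mult power_mult_distrib
           intro!: holomorphic_intros summable_mult)

lemma hardy2_add: "\<lbrakk>f \<in> hardy2; g \<in> hardy2\<rbrakk> \<Longrightarrow> (\<lambda>z. f z + g z) \<in> hardy2"
  by (auto simp: hardy2_def taylor_coeff_add intro!: holomorphic_intros summable_power2_add)

lemma hardy2_diff: "\<lbrakk>f \<in> hardy2; g \<in> hardy2\<rbrakk> \<Longrightarrow> (\<lambda>z. f z - g z) \<in> hardy2"
  using hardy2_add[OF _ hardy2_cmult, of f g "-1"] by simp

text \<open>The coefficients determine a function only inside the disk; outside it both functions
  are zero by the convention built into \<open>hardy2\<close>.\<close>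

lemma hardy2_eqI:
  assumes "f \<in> hardy2" "g \<in> hardy2" "\<And>n. taylor_coeff f n = taylor_coeff g n"
  shows "f = g"
proof
  fix z
  show "f z = g z"
  proof (cases "z \<in> ball 0 1")
    case True
    then have "(\<lambda>n. taylor_coeff f n * z ^ n) sums f z" "(\<lambda>n. taylor_coeff f n * z ^ n) sums g z"
      using taylor_coeff_sums[OF hardy2_holomorphic[OF assms(1)], of z]
        taylor_coeff_sums[OF hardy2_holomorphic[OF assms(2)], of z] assms(3) by auto
    then show ?thesis by (rule sums_unique2)
  next
    case False
    then show ?thesis
      using hardy2_off_disk[OF assms(1) False] hardy2_off_disk[OF assms(2) False] by simp
  qed
qed

section \<open>Inner product and norm\<close>

lemma hardy2_inner_summable:
  assumes "f \<in> hardy2" "g \<in> hardy2"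
  shows "summable (\<lambda>n. taylor_coeff f n * cnj (taylor_coeff g n))"
  by (rule summable_norm_cancel)
     (use l2_mult_summable(1)[OF assms[THEN hardy2_summable]] in \<open>simp add: norm_mult\<close>)

lemma hardy2_inner_diff_left:
  "\<lbrakk>f \<in> hardy2; g \<in> hardy2; h \<in> hardy2\<rbrakk>
    \<Longrightarrow> hardy2_inner (\<lambda>z. f z - g z) h = hardy2_inner f h - hardy2_inner g h"
  by (simp add: hardy2_inner_def taylor_coeff_diff hardy2_holomorphic ring_distribs
      suminf_diff hardy2_inner_summable)

lemma hardy2_inner_cmult_left:
  "\<lbrakk>f \<in> hardy2; h \<in> hardy2\<rbrakk> \<Longrightarrow> hardy2_inner (\<lambda>z. c * f z) h = c * hardy2_inner f h"
  by (simp add: hardy2_inner_def taylor_coeff_cmult hardy2_holomorphic mult.assoc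
      suminf_mult hardy2_inner_summable)

lemma hardy2_inner_commute:
  "\<lbrakk>f \<in> hardy2; g \<in> hardy2\<rbrakk> \<Longrightarrow> hardy2_inner g f = cnj (hardy2_inner f g)"
  unfolding hardy2_inner_def
  using bounded_linear.suminf[OF bounded_linear_cnj hardy2_inner_summable[of f g]]
  by (simp add: mult.commute)

lemma hardy2_inner_diff_right:
  "\<lbrakk>f \<in> hardy2; g \<in> hardy2; h \<in> hardy2\<rbrakk>
    \<Longrightarrow> hardy2_inner h (\<lambda>z. f z - g z) = hardy2_inner h f - hardy2_inner h g"
  \<comment> \<open>Conjugate symmetry transfers the left-hand rule to the right argument.\<close>
  by (subst (1 2 3) hardy2_inner_commute) (auto simp: hardy2_inner_diff_left hardy2_diff)

lemma hardy2_inner_cmult_right: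
  "\<lbrakk>f \<in> hardy2; h \<in> hardy2\<rbrakk> \<Longrightarrow> hardy2_inner h (\<lambda>z. c * f z) = cnj c * hardy2_inner h f"
  by (subst (1 2) hardy2_inner_commute) (auto simp: hardy2_inner_cmult_left hardy2_cmult)

lemma hardy2_inner_self:
  assumes "f \<in> hardy2"
  shows "hardy2_inner f f = of_real (\<Sum>n. (cmod (taylor_coeff f n))\<^sup>2)"
  unfolding hardy2_inner_def
  by (simp only: suminf_of_real[OF hardy2_summable[OF assms]] complex_norm_square)

lemma hardy2_norm_sq:
  "f \<in> hardy2 \<Longrightarrow> (hardy2_norm f)\<^sup>2 = (\<Sum>n. (cmod (taylor_coeff f n))\<^sup>2)"
  by (simp add: hardy2_norm_def hardy2_inner_self suminf_nonneg hardy2_summable)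

lemma hardy2_norm_eq:
  "f \<in> hardy2 \<Longrightarrow> hardy2_norm f = sqrt (\<Sum>n. (cmod (taylor_coeff f n))\<^sup>2)"
  by (simp add: hardy2_norm_def hardy2_inner_self)

lemma hardy2_inner_self_norm: "f \<in> hardy2 \<Longrightarrow> hardy2_inner f f = of_real ((hardy2_norm f)\<^sup>2)"
  by (simp add: hardy2_inner_self hardy2_norm_sq)

lemma hardy2_norm_nonneg: "f \<in> hardy2 \<Longrightarrow> hardy2_norm f \<ge> 0"
  by (simp add: hardy2_norm_eq suminf_nonneg hardy2_summable)

lemma hardy2_Cauchy_Schwarz:
  assumes "f \<in> hardy2" "g \<in> hardy2"
  shows "cmod (hardy2_inner f g) \<le> hardy2_norm f * hardy2_norm g"
proof -
  note s = l2_mult_summable[OF assms[THEN hardy2_summable]]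
  have "cmod (hardy2_inner f g) \<le> (\<Sum>n. cmod (taylor_coeff f n) * cmod (taylor_coeff g n))"
    unfolding hardy2_inner_def using summable_norm[of "\<lambda>n. taylor_coeff f n * cnj (taylor_coeff g n)"] s(1)
    by (simp add: norm_mult)
  also note s(2)
  finally show ?thesis using assms by (simp add: hardy2_norm_eq)
qed

lemma hardy2_eqI_norm_diff:
  assumes "f \<in> hardy2" "g \<in> hardy2" "hardy2_norm (\<lambda>z. f z - g z) = 0"
  shows "f = g"
proof (rule hardy2_eqI[OF assms(1,2)])
  fix n
  have "(\<Sum>n. (cmod (taylor_coeff (\<lambda>z. f z - g z) n))\<^sup>2) = 0"
    using assms(3) hardy2_norm_sq[OF hardy2_diff[OF assms(1,2)]] by simp
  then have "(cmod (taylor_coeff (\<lambda>z. f z - g z) n))\<^sup>2 = 0"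
    using suminf_eq_zero_iff[OF hardy2_summable[OF hardy2_diff[OF assms(1,2)]]] by simp
  then show "taylor_coeff f n = taylor_coeff g n"
    using assms by (simp add: taylor_coeff_diff hardy2_holomorphic)
qed

section \<open>Square-summable coefficient sequences and completeness\<close>

lemma hardy2_of_coeffs:
  fixes c :: "nat \<Rightarrow> complex"
  assumes c: "summable (\<lambda>n. (cmod (c n))\<^sup>2)"
  obtains f where "f \<in> hardy2" "\<And>n. taylor_coeff f n = c n"
proof -
  define f where "f = (\<lambda>z. if z \<in> ball 0 1 then \<Sum>n. c n * z ^ n else 0)"
  \<comment> \<open>For a point of the disk the powers \<open>z ^ n\<close> are square summable, so
    the power series converges absolutely by Cauchy-Schwarz.\<close>
  have sums: "(\<lambda>n. c n * z ^ n) sums f z" if z: "z \<in> ball 0 1" for z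
  proof -
    have "summable (\<lambda>n. (cmod (z ^ n))\<^sup>2)"
      using z summable_geometric[of "(cmod z)\<^sup>2"]
      by (simp add: norm_power abs_square_less_1 flip: power_mult) (simp add: mult.commute)
    then have "summable (\<lambda>n. cmod (c n) * cmod (z ^ n))"
      using l2_mult_summable(1)[OF c] by simp
    then have "summable (\<lambda>n. c n * z ^ n)"
      by (intro summable_norm_cancel[of "\<lambda>n. c n * z ^ n"]) (simp add: norm_mult)
    then show ?thesis using z by (simp add: f_def summable_sums)
  qed
  have holo: "f holomorphic_on ball 0 1"
    by (rule power_series_holomorphic[where a = c]) (use sums in simp)
  have "f has_fps_expansion Abs_fps c"
    by (rule has_fps_expansionI[OF eventually_mono[OF eventually_nhds_in_open[of "ball 0 1"]]])
       (use sums in auto)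
  then have "taylor_coeff f n = c n" for n
    using fps_nth_fps_expansion[of f "Abs_fps c" n] by (simp add: taylor_coeff_def)
  moreover from this holo c have "f \<in> hardy2"
    by (auto simp: hardy2_def f_def)
  ultimately show ?thesis using that by blast
qed

lemma hardy2_norm_cmult: "f \<in> hardy2 \<Longrightarrow> hardy2_norm (\<lambda>z. c * f z) = cmod c * hardy2_norm f"
  by (simp add: hardy2_norm_eq hardy2_cmult taylor_coeff_cmult hardy2_holomorphic norm_mult
      power_mult_distrib suminf_mult hardy2_summable real_sqrt_mult)

text \<open>This is the completeness of l2 read through Taylor coefficients: each coefficient
  converges, and finite partial sums carry the Cauchy bound over to the limit sequence.\<close>

lemma hardy2_complete:
  assumes X: "\<And>n. X n \<in> hardy2"
    and Cauchy: "\<And>e. e > 0 \<Longrightarrow> \<exists>N. \<forall>m\<ge>N. \<forall>n\<ge>N. hardy2_norm (\<lambda>z. X m z - X n z) < e"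
  obtains g where "g \<in> hardy2" "(\<lambda>n. hardy2_norm (\<lambda>z. X n z - g z)) \<longlonglongrightarrow> 0"
proof -
  have partial: "(\<Sum>k<K. (cmod (taylor_coeff (X m) k - taylor_coeff (X n) k))\<^sup>2)
      \<le> (hardy2_norm (\<lambda>z. X m z - X n z))\<^sup>2" for m n K
    using X hardy2_diff[OF X X, of m n]
      sum_le_suminf[OF hardy2_summable[OF hardy2_diff[OF X X, of m n]], of "{..<K}"]
    by (simp add: hardy2_norm_sq taylor_coeff_diff hardy2_holomorphic)
  have single: "cmod (taylor_coeff (X m) k - taylor_coeff (X n) k)
      \<le> hardy2_norm (\<lambda>z. X m z - X n z)" for m n k
  proof (rule power2_le_imp_le)
    have "(cmod (taylor_coeff (X m) k - taylor_coeff (X n) k))\<^sup>2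
        \<le> (\<Sum>k<Suc k. (cmod (taylor_coeff (X m) k - taylor_coeff (X n) k))\<^sup>2)"
      by (simp add: sum_nonneg)
    also note partial
    finally show "(cmod (taylor_coeff (X m) k - taylor_coeff (X n) k))\<^sup>2
        \<le> (hardy2_norm (\<lambda>z. X m z - X n z))\<^sup>2" .
  qed (simp add: hardy2_norm_nonneg hardy2_diff X)
  have "\<exists>c. (\<lambda>n. taylor_coeff (X n) k) \<longlonglongrightarrow> c" for k
  proof -
    have "Cauchy (\<lambda>n. taylor_coeff (X n) k)"
      unfolding Cauchy_def dist_norm using Cauchy single by (meson order_le_less_trans)
    then show ?thesis by (simp add: Cauchy_convergent_iff convergent_def)
  qed
  then obtain c where c: "\<And>k. (\<lambda>n. taylor_coeff (X n) k) \<longlonglongrightarrow> c k"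
    by metis
  \<comment> \<open>The index \<open>m\<close> goes to infinity while \<open>K\<close> is fixed, so
    only finite sums are passed to the limit; the bound is uniform in \<open>K\<close>.\<close>
  have tail: "\<exists>N. \<forall>n\<ge>N. \<forall>K. (\<Sum>k<K. (cmod (taylor_coeff (X n) k - c k))\<^sup>2) \<le> e\<^sup>2"
    if e: "e > 0" for e
  proof -
    obtain N where N: "\<And>m n. \<lbrakk>m \<ge> N; n \<ge> N\<rbrakk> \<Longrightarrow> hardy2_norm (\<lambda>z. X m z - X n z) < e"
      using Cauchy[OF e] by blast
    have "(\<Sum>k<K. (cmod (taylor_coeff (X n) k - c k))\<^sup>2) \<le> e\<^sup>2" if n: "n \<ge> N" for n K
    proof (rule LIMSEQ_le_const2)
      show "(\<lambda>m. \<Sum>k<K. (cmod (taylor_coeff (X n) k - taylor_coeff (X m) k))\<^sup>2)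
          \<longlonglongrightarrow> (\<Sum>k<K. (cmod (taylor_coeff (X n) k - c k))\<^sup>2)"
        by (intro tendsto_intros c)
      have "(\<Sum>k<K. (cmod (taylor_coeff (X n) k - taylor_coeff (X m) k))\<^sup>2) \<le> e\<^sup>2" if "m \<ge> N" for m
        using partial[where m = n and n = m and K = K] N[OF n that]
          power_mono[of "hardy2_norm (\<lambda>z. X n z - X m z)" e 2]
        by (force simp: hardy2_norm_nonneg hardy2_diff X)
      then show "\<exists>M. \<forall>m\<ge>M. (\<Sum>k<K. (cmod (taylor_coeff (X n) k - taylor_coeff (X m) k))\<^sup>2) \<le> e\<^sup>2"
        by blast
    qed
    then show ?thesis by blast
  qed
  \<comment> \<open>The limit sequence is square summable because it differs from one member of the
    sequence by a square-summable one.\<close>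
  obtain N1 where N1: "\<And>K. (\<Sum>k<K. (cmod (taylor_coeff (X N1) k - c k))\<^sup>2) \<le> 1"
    using tail[of 1] by auto
  have "summable (\<lambda>k. (cmod (taylor_coeff (X N1) k - c k))\<^sup>2)"
    by (rule summableI_nonneg_bounded[OF _ N1]) auto
  then have "summable (\<lambda>k. (cmod (c k - taylor_coeff (X N1) k))\<^sup>2)"
    by (simp add: norm_minus_commute)
  from summable_power2_add[OF this hardy2_summable[OF X[of N1]]]
  have "summable (\<lambda>k. (cmod (c k))\<^sup>2)" by simp
  then obtain g where g: "g \<in> hardy2" "\<And>n. taylor_coeff g n = c n"
    using hardy2_of_coeffs[of c] by blast
  have "(\<lambda>n. hardy2_norm (\<lambda>z. X n z - g z)) \<longlonglongrightarrow> 0"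
  proof (rule LIMSEQ_I)
    fix e :: real assume e: "e > 0"
    then obtain N where N: "\<And>n K. n \<ge> N \<Longrightarrow> (\<Sum>k<K. (cmod (taylor_coeff (X n) k - c k))\<^sup>2) \<le> (e/2)\<^sup>2"
      using tail[of "e/2"] by auto
    have "norm (hardy2_norm (\<lambda>z. X n z - g z) - 0) < e" if "n \<ge> N" for n
    proof -
      note Xg = hardy2_diff[OF X[of n] g(1)]
      have "(hardy2_norm (\<lambda>z. X n z - g z))\<^sup>2 \<le> (e/2)\<^sup>2"
        unfolding hardy2_norm_sq[OF Xg]
        by (rule suminf_le_const[OF hardy2_summable[OF Xg]])
           (use N[OF that] X g in \<open>simp add: taylor_coeff_diff hardy2_holomorphic\<close>)
      then have "hardy2_norm (\<lambda>z. X n z - g z) \<le> e/2"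
        using e power2_le_imp_le[of _ "e/2"] by simp
      then show ?thesis using hardy2_norm_nonneg[OF Xg] e by simp
    qed
    then show "\<exists>N. \<forall>n\<ge>N. norm (hardy2_norm (\<lambda>z. X n z - g z) - 0) < e" by blast
  qed
  then show ?thesis using that g by blast
qed

section \<open>Orthogonal projections\<close>

lemma hardy2_norm_sub_cmult:
  assumes u: "u \<in> hardy2" and h: "h \<in> hardy2"
  shows "(hardy2_norm (\<lambda>z. u z - t * h z))\<^sup>2
    = (hardy2_norm u)\<^sup>2 - 2 * Re (cnj t * hardy2_inner u h) + (cmod t)\<^sup>2 * (hardy2_norm h)\<^sup>2"
proof -
  let ?s = "hardy2_inner u h"
  note th = hardy2_cmult[OF h, of t]
  have "of_real ((hardy2_norm (\<lambda>z. u z - t * h z))\<^sup>2) = hardy2_inner (\<lambda>z. u z - t * h z) (\<lambda>z. u z - t * h z)"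
    by (simp only: hardy2_inner_self_norm[OF hardy2_diff[OF u th]])
  also have "\<dots> = hardy2_inner u u - cnj t * ?s - (t * cnj ?s - t * cnj t * hardy2_inner h h)"
    by (simp add: hardy2_inner_diff_left hardy2_inner_diff_right hardy2_inner_cmult_left
        hardy2_inner_cmult_right u h th hardy2_diff hardy2_inner_commute[OF u h])
  also have "\<dots> = of_real ((hardy2_norm u)\<^sup>2) - (cnj t * ?s + cnj (cnj t * ?s))
      + of_real ((cmod t)\<^sup>2 * (hardy2_norm h)\<^sup>2)"
    by (simp only: hardy2_inner_self_norm[OF u] hardy2_inner_self_norm[OF h] of_real_mult complex_norm_square[of t])
       (simp add: algebra_simps)
  also have "\<dots> = of_real ((hardy2_norm u)\<^sup>2 - 2 * Re (cnj t * ?s) + (cmod t)\<^sup>2 * (hardy2_norm h)\<^sup>2)"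
    by (simp only: complex_add_cnj of_real_add of_real_diff)
  finally show ?thesis by (simp only: of_real_eq_iff)
qed

text \<open>The notion is algebraic, which suffices for the uniqueness of projections. The
  closedness behind their existence comes from the orthogonal complements in
  \<open>hardy2_proj_exists\<close>.\<close>

definition hardy2_subspace :: "(complex \<Rightarrow> complex) set \<Rightarrow> bool" where
  "hardy2_subspace S \<longleftrightarrow> S \<subseteq> hardy2 \<and> (\<lambda>z. 0) \<in> S \<and>
     (\<forall>f\<in>S. \<forall>g\<in>S. (\<lambda>z. f z - g z) \<in> S) \<and> (\<forall>f\<in>S. \<forall>c. (\<lambda>z. c * f z) \<in> S)"

lemma hardy2_subspaceD:
  assumes "hardy2_subspace S"
  shows "f \<in> S \<Longrightarrow> f \<in> hardy2"
    and "\<lbrakk>f \<in> S; g \<in> S\<rbrakk> \<Longrightarrow> (\<lambda>z. f z - g z) \<in> S"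
    and "f \<in> S \<Longrightarrow> (\<lambda>z. c * f z) \<in> S"
    and "(\<lambda>z. 0) \<in> S"
  using assms unfolding hardy2_subspace_def by blast+

lemma hardy2_zero: "(\<lambda>z. 0) \<in> hardy2"
proof -
  have "taylor_coeff (\<lambda>z. 0) n = 0" for n
    using taylor_coeff_cmult[of "\<lambda>z. 0" 0 n] by simp
  then show ?thesis by (simp add: hardy2_def)
qed

lemma hardy2_inner_zero_left: "hardy2_inner (\<lambda>z. 0) h = 0"
proof -
  have "taylor_coeff (\<lambda>z. 0) n = 0" for n
    using taylor_coeff_cmult[of "\<lambda>z. 0" 0 n] by simp
  then show ?thesis by (simp add: hardy2_inner_def)
qed

lemma hardy2_subspace_hardy2: "hardy2_subspace hardy2"
  by (simp add: hardy2_subspace_def hardy2_zero hardy2_diff hardy2_cmult)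

lemma hardy2_subspace_ominus:
  assumes "hardy2_subspace S" "M \<subseteq> hardy2"
  shows "hardy2_subspace (hardy2_ominus S M)"
  using assms unfolding hardy2_subspace_def hardy2_ominus_def
  by (auto simp: hardy2_inner_diff_left hardy2_inner_cmult_left hardy2_inner_zero_left subset_iff)

text \<open>The difference of two candidates lies in \<open>S\<close> and is orthogonal to
  \<open>S\<close>, hence to itself. This turns the definite description into a usable
  characterization.\<close>

lemma hardy2_proj_eqI:
  assumes S: "hardy2_subspace S" and f: "f \<in> hardy2" and g: "g \<in> S"
    and orth: "\<And>h. h \<in> S \<Longrightarrow> hardy2_inner (\<lambda>z. f z - g z) h = 0"
  shows "hardy2_proj S f = g"
  unfolding hardy2_proj_def
proof (rule the_equality)
  show "g \<in> S \<and> (\<forall>h\<in>S. hardy2_inner (\<lambda>z. f z - g z) h = 0)" using g orth by blast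
next
  fix g' assume g': "g' \<in> S \<and> (\<forall>h\<in>S. hardy2_inner (\<lambda>z. f z - g' z) h = 0)"
  have H: "g \<in> hardy2" "g' \<in> hardy2" using hardy2_subspaceD(1)[OF S] g g' by blast+
  define h where "h = (\<lambda>z. g z - g' z)"
  have hS: "h \<in> S" using hardy2_subspaceD(2)[OF S] g g' unfolding h_def by blast
  then have h: "h \<in> hardy2" by (rule hardy2_subspaceD(1)[OF S])
  have "hardy2_inner h h = hardy2_inner (\<lambda>z. f z - g' z) h - hardy2_inner (\<lambda>z. f z - g z) h"
    using H h f by (simp add: hardy2_inner_diff_left) (simp add: h_def hardy2_inner_diff_left[OF H] H hardy2_diff)
  also have "\<dots> = 0" using g' orth hS by simp
  finally have "hardy2_norm h = 0" using h by (simp add: hardy2_inner_self_norm)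
  then show "g' = g" using hardy2_eqI_norm_diff[OF H] by (simp add: h_def)
qed

text \<open>A sequence minimizing the distance from \<open>f\<close> to \<open>S\<close> is Cauchy.
  Its limit stays in \<open>S\<close> because orthogonality to \<open>M\<close> survives norm
  limits, and the residual becomes orthogonal to \<open>S\<close> in the limit.\<close>

lemma hardy2_proj_exists:
  assumes M: "M \<subseteq> hardy2" and f: "f \<in> hardy2"
  defines "S \<equiv> hardy2_ominus hardy2 M"
  shows "\<exists>g\<in>S. \<forall>h\<in>S. hardy2_inner (\<lambda>z. f z - g z) h = 0"
proof -
  have sub: "hardy2_subspace S"
    unfolding S_def by (intro hardy2_subspace_ominus hardy2_subspace_hardy2 M)
  have SH: "g \<in> hardy2" if "g \<in> S" for g using that by (rule hardy2_subspaceD(1)[OF sub])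
  define d where "d = (INF g\<in>S. (hardy2_norm (\<lambda>z. f z - g z))\<^sup>2)"
  have bdd: "bdd_below ((\<lambda>g. (hardy2_norm (\<lambda>z. f z - g z))\<^sup>2) ` S)"
    by (rule bdd_belowI2[where m = 0]) auto
  have ne: "S \<noteq> {}" using hardy2_subspaceD(4)[OF sub] by blast
  have d_le: "d \<le> (hardy2_norm (\<lambda>z. f z - g z))\<^sup>2" if "g \<in> S" for g
    unfolding d_def by (rule cINF_lower[OF bdd that])
  \<comment> \<open>Minimality of \<open>d\<close> along the best multiple of \<open>h\<close>; this makes a minimizing sequence Cauchy and its
    limit orthogonal, without the parallelogram law.\<close>
  have near_orth: "(cmod (hardy2_inner (\<lambda>z. f z - g z) h))\<^sup>2
      \<le> (hardy2_norm h)\<^sup>2 * ((hardy2_norm (\<lambda>z. f z - g z))\<^sup>2 - d)" if g: "g \<in> S" and h: "h \<in> S" for g h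
  proof (cases "hardy2_norm h = 0")
    \<comment> \<open>The multiple \<open>t\<close> used in the other case divides by the squared
      norm of \<open>h\<close>; for a null \<open>h\<close> both sides vanish by
      Cauchy-Schwarz.\<close>
    case True
    then show ?thesis
      using hardy2_Cauchy_Schwarz[OF hardy2_diff[OF f SH[OF g]] SH[OF h]] by simp
  next
    case False
    define s where "s = hardy2_inner (\<lambda>z. f z - g z) h"
    define t where "t = s / of_real ((hardy2_norm h)\<^sup>2)"
    \<comment> \<open>The competitor is \<open>g + t h\<close>, written as a difference to match the
      closure property of subspaces.\<close>
    have "(\<lambda>z. g z - (- t) * h z) \<in> S"
      by (intro hardy2_subspaceD(2,3)[OF sub] g h)
    then have "d \<le> (hardy2_norm (\<lambda>z. f z - (g z - (- t) * h z)))\<^sup>2" by (rule d_le)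
    also have "(\<lambda>z. f z - (g z - (- t) * h z)) = (\<lambda>z. (f z - g z) - t * h z)"
      by (simp add: algebra_simps)
    also have "(hardy2_norm \<dots>)\<^sup>2 = (hardy2_norm (\<lambda>z. f z - g z))\<^sup>2 - 2 * Re (cnj t * s)
        + (cmod t)\<^sup>2 * (hardy2_norm h)\<^sup>2"
      unfolding s_def by (rule hardy2_norm_sub_cmult[OF hardy2_diff[OF f SH[OF g]] SH[OF h]])
    also have "Re (cnj t * s) = (cmod s)\<^sup>2 / (hardy2_norm h)\<^sup>2"
    proof -
      have "cnj t * s = of_real ((cmod s)\<^sup>2 / (hardy2_norm h)\<^sup>2)"
        by (simp only: t_def complex_norm_square of_real_divide complex_cnj_divide complex_cnj_complex_of_real
            times_divide_eq_right mult.commute[of "cnj s / of_real x" s for x])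
      then show ?thesis by (simp only: Re_complex_of_real)
    qed
    also have "(cmod t)\<^sup>2 * (hardy2_norm h)\<^sup>2 = (cmod s)\<^sup>2 / (hardy2_norm h)\<^sup>2"
    proof -
      have "cmod t = cmod s / (hardy2_norm h)\<^sup>2"
        unfolding t_def norm_divide norm_of_real by simp
      then show ?thesis using False by (simp add: power_divide power2_eq_square)
    qed
    finally have "(cmod s)\<^sup>2 / (hardy2_norm h)\<^sup>2 \<le> (hardy2_norm (\<lambda>z. f z - g z))\<^sup>2 - d"
      by linarith
    then show ?thesis using False unfolding s_def[symmetric]
      by (subst (asm) pos_divide_le_eq) (simp_all add: mult.commute)
  qed
  have "\<exists>g\<in>S. (hardy2_norm (\<lambda>z. f z - g z))\<^sup>2 < d + inverse (real (Suc n))" for n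
    using cINF_less_iff[OF ne bdd, of "d + inverse (real (Suc n))"] by (simp add: d_def)
  then obtain X where XS: "\<And>n. X n \<in> S"
    and X: "\<And>n. (hardy2_norm (\<lambda>z. f z - X n z))\<^sup>2 < d + inverse (real (Suc n))"
    by metis
  have XH: "X n \<in> hardy2" for n using SH XS by blast
  have orth: "cmod (hardy2_inner (\<lambda>z. f z - X n z) h) \<le> hardy2_norm h * sqrt (inverse (real (Suc n)))"
    if h: "h \<in> S" for n h
  proof (rule power2_le_imp_le)
    have "(cmod (hardy2_inner (\<lambda>z. f z - X n z) h))\<^sup>2 \<le> (hardy2_norm h)\<^sup>2 * inverse (real (Suc n))"
      using X[of n] by (intro order_trans[OF near_orth[OF XS h]] mult_left_mono) auto
    then show "(cmod (hardy2_inner (\<lambda>z. f z - X n z) h))\<^sup>2 \<le> (hardy2_norm h * sqrt (inverse (real (Suc n))))\<^sup>2"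
      by (simp add: power_mult_distrib)
  qed (simp add: hardy2_norm_nonneg SH h)
  \<comment> \<open>The difference \<open>h\<close> of two members is tested against itself: its
    squared norm is the difference of the two residuals' inner products with \<open>h\<close>, each
    controlled by \<open>orth\<close>. Dividing by the norm of \<open>h\<close> gives the
    bound.\<close>
  have dist: "hardy2_norm (\<lambda>z. X m z - X n z) \<le> sqrt (inverse (real (Suc n))) + sqrt (inverse (real (Suc m)))" for m n
  proof -
    define h where "h = (\<lambda>z. X m z - X n z)"
    have hS: "h \<in> S" unfolding h_def by (intro hardy2_subspaceD(2)[OF sub] XS)
    note hH = SH[OF hS]
    have "of_real ((hardy2_norm h)\<^sup>2) = hardy2_inner h h"
      by (simp add: hardy2_inner_self_norm hH)
    also have "\<dots> = hardy2_inner (\<lambda>z. f z - X n z) h - hardy2_inner (\<lambda>z. f z - X m z) h"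
      using XH hH f by (simp add: hardy2_inner_diff_left) (simp add: h_def hardy2_inner_diff_left hardy2_diff XH)
    finally have eq: "complex_of_real ((hardy2_norm h)\<^sup>2) = hardy2_inner (\<lambda>z. f z - X n z) h - hardy2_inner (\<lambda>z. f z - X m z) h" .
    have "(hardy2_norm h)\<^sup>2 = cmod (hardy2_inner (\<lambda>z. f z - X n z) h - hardy2_inner (\<lambda>z. f z - X m z) h)"
      unfolding eq[symmetric] by (simp only: norm_of_real) simp
    also have "\<dots> \<le> hardy2_norm h * sqrt (inverse (real (Suc n))) + hardy2_norm h * sqrt (inverse (real (Suc m)))"
      by (rule order_trans[OF norm_triangle_ineq4 add_mono[OF orth[OF hS] orth[OF hS]]])
    finally have "hardy2_norm h * hardy2_norm h \<le> hardy2_norm h * (sqrt (inverse (real (Suc n))) + sqrt (inverse (real (Suc m))))"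
      by (simp add: power2_eq_square distrib_left)
    then show ?thesis using hardy2_norm_nonneg[OF hH]
      by (cases "hardy2_norm h = 0") (auto simp: h_def)
  qed
  have lim0: "(\<lambda>n. sqrt (inverse (real (Suc n)))) \<longlonglongrightarrow> 0"
    using tendsto_real_sqrt[OF LIMSEQ_inverse_real_of_nat] by simp
  have "\<exists>N. \<forall>m\<ge>N. \<forall>n\<ge>N. hardy2_norm (\<lambda>z. X m z - X n z) < e" if e: "e > 0" for e
  proof -
    have "\<forall>\<^sub>F n in sequentially. sqrt (inverse (real (Suc n))) < e/2"
      using order_tendstoD(2)[OF lim0, of "e/2"] e by simp
    then obtain N where N: "\<And>n. n \<ge> N \<Longrightarrow> sqrt (inverse (real (Suc n))) < e/2"
      unfolding eventually_sequentially by blast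
    have "hardy2_norm (\<lambda>z. X m z - X n z) < e" if "m \<ge> N" "n \<ge> N" for m n
      using dist[of m n] N[OF that(1)] N[OF that(2)] by linarith
    then show ?thesis by blast
  qed
  then obtain g where g: "g \<in> hardy2" "(\<lambda>n. hardy2_norm (\<lambda>z. X n z - g z)) \<longlonglongrightarrow> 0"
    using hardy2_complete[of X, OF XH] by blast
  \<comment> \<open>Inner products with a fixed element pass to the limit; this serves both for
    membership of \<open>g\<close> in \<open>S\<close> and for orthogonality of the
    residual.\<close>
  have weak: "(\<lambda>n. hardy2_inner (X n) h) \<longlonglongrightarrow> hardy2_inner g h" if h: "h \<in> hardy2" for h
  proof (rule LIM_zero_cancel, rule Lim_null_comparison)
    show "\<forall>\<^sub>F n in sequentially. norm (hardy2_inner (X n) h - hardy2_inner g h)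
        \<le> hardy2_norm (\<lambda>z. X n z - g z) * hardy2_norm h"
      using hardy2_Cauchy_Schwarz[OF hardy2_diff[OF XH g(1)] h]
      by (simp add: hardy2_inner_diff_left XH g h)
    show "(\<lambda>n. hardy2_norm (\<lambda>z. X n z - g z) * hardy2_norm h) \<longlonglongrightarrow> 0"
      using tendsto_mult_right[OF g(2), of "hardy2_norm h"] by simp
  qed
  have "hardy2_inner g h = 0" if "h \<in> M" for h
  proof -
    have "hardy2_inner (X n) h = 0" for n
      using XS[of n] that by (simp add: S_def hardy2_ominus_def)
    then have "(\<lambda>n. 0 :: complex) \<longlonglongrightarrow> hardy2_inner g h"
      using weak[of h] that M by (simp add: subset_iff)
    then show ?thesis by (simp add: LIMSEQ_const_iff)
  qed
  then have gS: "g \<in> S" using g by (simp add: S_def hardy2_ominus_def)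
  have "hardy2_inner (\<lambda>z. f z - g z) h = 0" if h: "h \<in> S" for h
  proof (rule LIMSEQ_unique)
    show "(\<lambda>n. hardy2_inner (\<lambda>z. f z - X n z) h) \<longlonglongrightarrow> hardy2_inner (\<lambda>z. f z - g z) h"
      using tendsto_diff[OF tendsto_const weak[OF SH[OF h]], of "hardy2_inner f h"]
      by (simp add: hardy2_inner_diff_left f XH g SH h)
    show "(\<lambda>n. hardy2_inner (\<lambda>z. f z - X n z) h) \<longlonglongrightarrow> 0"
      by (rule Lim_null_comparison[OF always_eventually[OF allI[OF orth[OF h]]]])
         (use tendsto_mult_left[OF lim0, of "hardy2_norm h"] in simp)
  qed
  then show ?thesis using gS by blast
qed

section \<open>Reproducing kernels\<close>

lemma hardy2_kernel:
  assumes w: "cmod w < 1"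
  obtains k where "k \<in> hardy2" "\<And>n. taylor_coeff k n = cnj w ^ n"
    "\<And>f. f \<in> hardy2 \<Longrightarrow> hardy2_inner f k = f w"
    "(hardy2_norm k)\<^sup>2 = 1 / (1 - (cmod w)\<^sup>2)"
proof -
  have eq: "(cmod (cnj w ^ n))\<^sup>2 = ((cmod w)\<^sup>2) ^ n" for n
    by (simp add: norm_power flip: power_mult) (simp add: mult.commute)
  have w2: "(cmod w)\<^sup>2 < 1" using w by (simp add: abs_square_less_1)
  have "summable (\<lambda>n. (cmod (cnj w ^ n))\<^sup>2)"
    unfolding eq using w2 by (simp add: summable_geometric)
  \<comment> \<open>This is the Szego kernel \<open>1 / (1 - cnj w * z)\<close> on the disk.
    Building it from its coefficients places it in \<open>hardy2\<close> at once, and pairing with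
    it sums the Taylor series at \<open>w\<close>.\<close>
  then obtain k where k: "k \<in> hardy2" "\<And>n. taylor_coeff k n = cnj w ^ n"
    using hardy2_of_coeffs[of "\<lambda>n. cnj w ^ n"] by blast
  have "hardy2_inner f k = f w" if "f \<in> hardy2" for f
    using taylor_coeff_sums[OF hardy2_holomorphic[OF that] w]
    by (simp add: hardy2_inner_def k sums_iff)
  moreover have "(hardy2_norm k)\<^sup>2 = 1 / (1 - (cmod w)\<^sup>2)"
    using w2 by (simp add: hardy2_norm_sq k eq suminf_geometric del: complex_cnj_power)
  ultimately show ?thesis using that k by blast
qed

section \<open>Multiplication by bounded holomorphic functions\<close>

text \<open>On the circle of radius \<open>r\<close> one has \<open>cnj z = r^2 / z\<close>. So
  \<open>f z / z\<close> times a conjugated Taylor polynomial is a combination of the integrands in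
  Cauchy's coefficient formula, and uniform convergence on the circle turns the polynomials into
  \<open>f\<close>.\<close>

lemma parseval_circle:
  assumes f: "f holomorphic_on ball 0 1" and r: "0 < r" "r < 1"
  shows "summable (\<lambda>n. (cmod (taylor_coeff f n))\<^sup>2 * r ^ (2 * n))" (is "summable ?a")
    and "((\<lambda>t. (cmod (f (of_real r * cis t)))\<^sup>2) has_integral 2 * pi * (\<Sum>n. (cmod (taylor_coeff f n))\<^sup>2 * r ^ (2 * n)))
          {0..2 * pi}"
proof -
  let ?c = "taylor_coeff f"
  define q where "q N z = (\<Sum>n<N. cnj (?c n) * of_real (r ^ (2 * n)) * (f z / z ^ Suc n))" for N z
  have cont: "continuous_on (cball 0 r) f"
    using r by (intro holomorphic_on_imp_continuous_on holomorphic_on_subset[OF f]) auto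
  have holo: "f holomorphic_on ball 0 r"
    using r by (intro holomorphic_on_subset[OF f]) auto
  have coeff: "((\<lambda>z. f z / z ^ Suc n) has_contour_integral 2 * pi * \<i> * ?c n) (circlepath 0 r)" for n
    using Cauchy_has_contour_integral_higher_derivative_circlepath[OF cont holo, of 0 n] r
    by (simp add: taylor_coeff_def)
  have q_int: "(q N has_contour_integral 2 * pi * \<i> * of_real (\<Sum>n<N. ?a n)) (circlepath 0 r)" for N
  proof -
    have "(q N has_contour_integral (\<Sum>n<N. cnj (?c n) * of_real (r ^ (2 * n)) * (2 * pi * \<i> * ?c n))) (circlepath 0 r)"
      unfolding q_def by (intro has_contour_integral_sum has_contour_integral_lmul coeff finite_lessThan)
    also have "(\<Sum>n<N. cnj (?c n) * of_real (r ^ (2 * n)) * (2 * pi * \<i> * ?c n))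
        = 2 * pi * \<i> * of_real (\<Sum>n<N. ?a n)"
      unfolding of_real_sum sum_distrib_left of_real_mult complex_norm_square
      by (intro sum.cong) auto
    finally show ?thesis .
  qed
  define s where "s N z = (\<Sum>n<N. ?c n * z ^ n)" for N z
  have q_eq: "q N z = f z / z * cnj (s N z)" if z: "z \<in> sphere 0 r" for N z
  proof -
    have z0: "z \<noteq> 0" and nz: "cmod z = r" using z r by auto
    have "cnj (?c n) * of_real (r ^ (2 * n)) * (f z / z ^ Suc n) = f z / z * cnj (?c n * z ^ n)" for n
    proof -
      have "complex_of_real (r ^ (2 * n)) = z ^ n * cnj z ^ n"
        using nz complex_norm_square[of z] by (simp add: power_mult power_mult_distrib)
      then show ?thesis using z0 by (simp add: field_simps)
    qed
    then show ?thesis by (simp only: q_def s_def cnj_sum sum_distrib_left)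
  qed
  have conv1: "uniform_limit (cball 0 r) s f sequentially"
  proof -
    have "summable (\<lambda>n. cmod (?c n) * r ^ n)"
    proof -
      \<comment> \<open>Convergence at an intermediate radius forces absolute convergence at
        \<open>r\<close>, which the Weierstrass test requires.\<close>
      obtain r' where r': "r < r'" "r' < 1" using r dense by blast
      have "summable (\<lambda>n. ?c n * of_real r' ^ n)"
        using taylor_coeff_sums[OF f, of "of_real r'"] r r' by (auto simp: sums_iff)
      from powser_insidea[OF this, of "of_real r"] r r' show ?thesis
        by (simp add: norm_mult norm_power)
    qed
    moreover have "norm (?c n * z ^ n) \<le> cmod (?c n) * r ^ n" if "z \<in> cball 0 r" for n z
      using that by (auto simp: norm_mult norm_power intro!: mult_left_mono power_mono)
    ultimately have "uniform_limit (cball 0 r) (\<lambda>N z. \<Sum>n<N. ?c n * z ^ n) (\<lambda>z. \<Sum>n. ?c n * z ^ n) sequentially"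
      by (intro Weierstrass_m_test) auto
    moreover have "(\<Sum>n. ?c n * z ^ n) = f z" if "z \<in> cball 0 r" for z
      using taylor_coeff_sums[OF f, of z] that r by (auto simp: sums_iff)
    ultimately show ?thesis
      unfolding s_def by (smt (verit) uniform_limit_cong')
  qed
  have contS: "continuous_on (sphere 0 r) f"
    by (rule continuous_on_subset[OF cont]) auto
  have "uniform_limit (sphere 0 r) (\<lambda>N z. f z / z * cnj (s N z)) (\<lambda>z. f z / z * cnj (f z)) sequentially"
  proof (rule uniform_lim_mult)
    show "uniform_limit (sphere 0 r) (\<lambda>N z. cnj (s N z)) (\<lambda>z. cnj (f z)) sequentially"
      by (intro uniform_limit_intros uniform_limit_on_subset[OF conv1]) auto
    show "bounded ((\<lambda>z. f z / z) ` sphere 0 r)" "bounded ((\<lambda>z. cnj (f z)) ` sphere 0 r)"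
      using r by (auto intro!: compact_imp_bounded compact_continuous_image continuous_intros contS)
  qed (rule uniform_limit_const)
  then have ulim: "uniform_limit (sphere 0 r) q (\<lambda>z. f z / z * cnj (f z)) sequentially"
    by (rule uniform_limit_cong'[THEN iffD1, rotated 2]) (use q_eq in auto)
  have q_cint: "\<forall>\<^sub>F N in sequentially. q N contour_integrable_on circlepath 0 r"
    using q_int unfolding contour_integrable_on_def by (intro always_eventually allI exI)
  define I where "I = contour_integral (circlepath 0 r) (\<lambda>z. f z / z * cnj (f z))"
  note lim = contour_integral_uniform_limit_circlepath[OF q_cint _ _ r(1)]
  have int: "((\<lambda>z. f z / z * cnj (f z)) has_contour_integral I) (circlepath 0 r)"
    unfolding I_def using ulim by (intro has_contour_integral_integral lim(1)) auto
  have "(\<lambda>N. contour_integral (circlepath 0 r) (q N)) \<longlonglongrightarrow> I"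
    unfolding I_def by (rule lim(2)) (use ulim in auto)
  then have "(\<lambda>N. 2 * pi * \<i> * of_real (\<Sum>n<N. ?a n)) \<longlonglongrightarrow> I"
    by (simp only: contour_integral_unique[OF q_int])
  \<comment> \<open>The partial sums are real and occur with the factor
    \<open>2 * pi * \<i>\<close>; dividing by \<open>2 * pi\<close> and taking imaginary parts
    isolates them.\<close>
  from tendsto_Im[OF tendsto_divide[OF this tendsto_const[of "2 * complex_of_real pi"]]]
  have sums: "?a sums (Im I / (2 * pi))"
    by (simp add: sums_def Im_divide_of_real flip: of_real_mult of_real_sum)
  show "summable ?a" using sums by (rule sums_summable)
  \<comment> \<open>In the parametrization by angle, \<open>dz = \<i> z dt\<close> cancels the
    factor \<open>1 / z\<close>, leaving \<open>\<i>\<close> times the squared modulus.\<close>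
  have "((\<lambda>t. \<i> * of_real ((cmod (f (of_real r * cis t)))\<^sup>2)) has_integral I) {0..2 * pi}"
  proof -
    have "f (of_real r * cis t) / (of_real r * cis t) * cnj (f (of_real r * cis t)) * of_real r * \<i> * cis t
        = \<i> * of_real ((cmod (f (of_real r * cis t)))\<^sup>2)" for t
    proof -
      define w where "w = of_real r * cis t"
      have "w \<noteq> 0" using r by (simp add: w_def)
      have "f w / w * cnj (f w) * of_real r * \<i> * cis t = f w / w * cnj (f w) * \<i> * w"
        by (simp add: w_def)
      also have "\<dots> = \<i> * (f w * cnj (f w))" using \<open>w \<noteq> 0\<close> by simp
      finally show ?thesis by (simp only: w_def complex_norm_square)
    qed
    then show ?thesis
      using int[unfolded circlepath_def, THEN has_contour_integral_part_circlepath_iff[THEN iffD1, rotated]]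
      by (simp only: add_0) simp
  qed
  from has_integral_linear[OF this bounded_linear_Im]
  have "((\<lambda>t. (cmod (f (of_real r * cis t)))\<^sup>2) has_integral Im I) {0..2 * pi}"
    by (simp add: o_def)
  then show "((\<lambda>t. (cmod (f (of_real r * cis t)))\<^sup>2) has_integral 2 * pi * (\<Sum>n. ?a n)) {0..2 * pi}"
    using sums by (simp add: sums_iff)
qed

text \<open>No boundary values are involved: the pointwise bound is integrated over circles of
  radius less than one by Parseval, and the radius tends to one afterwards.\<close>

lemma hardy2_mult_contraction:
  assumes u: "u holomorphic_on ball 0 1" "\<And>z. cmod z < 1 \<Longrightarrow> cmod (u z) \<le> 1" and f: "f \<in> hardy2"
  shows "(\<lambda>z. u z * f z) \<in> hardy2" and "hardy2_norm (\<lambda>z. u z * f z) \<le> hardy2_norm f"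
proof -
  let ?g = "\<lambda>z. u z * f z"
  have g: "?g holomorphic_on ball 0 1"
    by (intro holomorphic_intros u hardy2_holomorphic f)
  have disk: "(\<Sum>n<N. (cmod (taylor_coeff ?g n))\<^sup>2 * r ^ (2 * n)) \<le> (hardy2_norm f)\<^sup>2"
    if r: "0 < r" "r < 1" for r N
  proof -
    note pg = parseval_circle[OF g r] and pf = parseval_circle[OF hardy2_holomorphic[OF f] r]
    have "2 * pi * (\<Sum>n. (cmod (taylor_coeff ?g n))\<^sup>2 * r ^ (2 * n))
        \<le> 2 * pi * (\<Sum>n. (cmod (taylor_coeff f n))\<^sup>2 * r ^ (2 * n))"
    proof (rule has_integral_le[OF pg(2) pf(2)])
      fix t
      have "cmod (of_real r * cis t) < 1" using r by (simp add: norm_mult)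
      then have "cmod (u (of_real r * cis t)) * cmod (f (of_real r * cis t)) \<le> cmod (f (of_real r * cis t))"
        using u(2) by (simp add: mult_left_le_one_le)
      then show "(cmod (u (of_real r * cis t) * f (of_real r * cis t)))\<^sup>2 \<le> (cmod (f (of_real r * cis t)))\<^sup>2"
        by (intro power_mono) (auto simp: norm_mult)
    qed
    then have "(\<Sum>n. (cmod (taylor_coeff ?g n))\<^sup>2 * r ^ (2 * n))
        \<le> (\<Sum>n. (cmod (taylor_coeff f n))\<^sup>2 * r ^ (2 * n))" by simp
    also have "\<dots> \<le> (hardy2_norm f)\<^sup>2"
      unfolding hardy2_norm_sq[OF f] using r
      by (intro suminf_le pf(1) hardy2_summable[OF f] mult_left_le power_le_one) auto
    finally show ?thesis
      using sum_le_suminf[OF pg(1), of "{..<N}"] r by simp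
  qed
  \<comment> \<open>A finite sum is a polynomial in \<open>r\<close>, so it passes to the limit
    \<open>r = 1\<close> from the left. The bounded partial sums then give square summability of the
    product's coefficients.\<close>
  have partial: "(\<Sum>n<N. (cmod (taylor_coeff ?g n))\<^sup>2) \<le> (hardy2_norm f)\<^sup>2" for N
  proof (rule tendsto_upperbound)
    have "((\<lambda>r. \<Sum>n<N. (cmod (taylor_coeff ?g n))\<^sup>2 * r ^ (2 * n))
        \<longlongrightarrow> (\<Sum>n<N. (cmod (taylor_coeff ?g n))\<^sup>2 * 1 ^ (2 * n))) (at_left (1::real))"
      by (intro tendsto_intros)
    then show "((\<lambda>r. \<Sum>n<N. (cmod (taylor_coeff ?g n))\<^sup>2 * r ^ (2 * n))
        \<longlongrightarrow> (\<Sum>n<N. (cmod (taylor_coeff ?g n))\<^sup>2)) (at_left (1::real))" by simp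
    show "\<forall>\<^sub>F r in at_left 1. (\<Sum>n<N. (cmod (taylor_coeff ?g n))\<^sup>2 * r ^ (2 * n)) \<le> (hardy2_norm f)\<^sup>2"
      by (rule eventually_mono[OF eventually_at_left_real[of 0 1]]) (use disk in auto)
  qed simp
  have sum: "summable (\<lambda>n. (cmod (taylor_coeff ?g n))\<^sup>2)"
    by (rule summableI_nonneg_bounded[OF _ partial]) auto
  then show gH: "?g \<in> hardy2"
    using g hardy2_off_disk[OF f] by (auto simp: hardy2_def)
  have "(hardy2_norm ?g)\<^sup>2 \<le> (hardy2_norm f)\<^sup>2"
    unfolding hardy2_norm_sq[OF gH] by (rule suminf_le_const[OF sum partial])
  then show "hardy2_norm ?g \<le> hardy2_norm f"
    using hardy2_norm_nonneg[OF f] by (rule power2_le_imp_le)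
qed

section \<open>Blaschke products\<close>

lemma one_minus_cnj_mult_nonzero:
  assumes "cmod a < 1" "cmod z \<le> 1"
  shows "1 - cnj a * z \<noteq> 0"
proof
  assume "1 - cnj a * z = 0"
  then have "cnj a * z = 1" by simp
  then have "cmod a * cmod z = 1" by (metis complex_mod_cnj norm_mult norm_one)
  then show False using assms mult_le_one[of "cmod a" "cmod z"] mult_left_le[of "cmod z" "cmod a"] by auto
qed

text \<open>This identity yields the exact defect of a factor from modulus one, and for points of
  the disk it also shows \<open>cmod (a - z) \<le> cmod (1 - cnj a * z)\<close>.\<close>

lemma cmod_one_minus_cnj_mult_sq:
  "(cmod (1 - cnj a * z))\<^sup>2 - (cmod (a - z))\<^sup>2 = (1 - (cmod a)\<^sup>2) * (1 - (cmod z)\<^sup>2)"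
  by (simp add: cmod_power2) (simp add: power2_eq_square algebra_simps)

lemma cmod_blaschke_factor:
  assumes "a \<noteq> 0"
  shows "cmod (blaschke_factor a z) = cmod (a - z) / cmod (1 - cnj a * z)"
  using assms by (simp add: blaschke_factor_def norm_mult norm_divide)

lemma one_minus_cmod_blaschke_factor_sq:
  assumes "cmod a < 1" "cmod z < 1"
  shows "1 - (cmod (blaschke_factor a z))\<^sup>2
    = (1 - (cmod a)\<^sup>2) * (1 - (cmod z)\<^sup>2) / (cmod (1 - cnj a * z))\<^sup>2"
proof (cases "a = 0")
  case True
  then show ?thesis by (simp add: blaschke_factor_def)
next
  case False
  have "cmod (1 - cnj a * z) \<noteq> 0"
    using one_minus_cnj_mult_nonzero[of a z] assms by simp
  then show ?thesis
    unfolding cmod_blaschke_factor[OF False] cmod_one_minus_cnj_mult_sq[symmetric]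
    by (simp add: power_divide diff_divide_distrib)
qed

lemma cmod_blaschke_factor_le_1:
  assumes "cmod a < 1" "cmod z < 1"
  shows "cmod (blaschke_factor a z) \<le> 1"
proof -
  have "0 \<le> 1 - (cmod (blaschke_factor a z))\<^sup>2"
    unfolding one_minus_cmod_blaschke_factor_sq[OF assms] using assms
    by (intro divide_nonneg_nonneg mult_nonneg_nonneg) (auto simp: power_le_one)
  then show ?thesis by (simp add: abs_square_le_1)
qed

text \<open>The unimodular normalization makes the numerator of
  \<open>1 - blaschke_factor a z\<close> split off \<open>1 - cmod a\<close>, which is how the
  Blaschke condition enters the convergence of the product.\<close>

lemma cmod_one_minus_blaschke_factor:
  assumes a: "cmod a < 1" and z: "cmod z < 1"
  shows "cmod (1 - blaschke_factor a z) \<le> (1 - cmod a) * (2 / (1 - cmod z))"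
proof (cases "a = 0")
  case True
  have "cmod (1 - z) \<le> 1 + cmod z" using norm_triangle_ineq4[of 1 z] by simp
  also have "\<dots> \<le> 2" using z by simp
  also have "\<dots> \<le> 2 / (1 - cmod z)" using z by (simp add: pos_le_divide_eq)
  finally show ?thesis using True by (simp add: blaschke_factor_def)
next
  case False
  \<comment> \<open>The relations \<open>cnj a = cmod a * u\<close> and
    \<open>u * a = cmod a\<close> turn the numerator into
    \<open>(1 - cmod a) * (1 + u * z)\<close>.\<close>
  define u where "u = cnj a / of_real (cmod a)"
  have u: "cmod u = 1" using False by (simp add: u_def norm_divide)
  have ca: "cnj a = of_real (cmod a) * u" using False by (simp add: u_def)
  have ua: "u * a = of_real (cmod a)"
    using False complex_norm_square[of a] by (simp add: u_def power2_eq_square field_simps)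
  have nz: "1 - cnj a * z \<noteq> 0" using one_minus_cnj_mult_nonzero[of a z] a z by simp
  have "1 - blaschke_factor a z = ((1 - cnj a * z) - (u * a - u * z)) / (1 - cnj a * z)"
    using False nz by (simp add: blaschke_factor_def u_def[symmetric] diff_divide_distrib right_diff_distrib)
  also have "(1 - cnj a * z) - (u * a - u * z) = of_real (1 - cmod a) * (1 + u * z)"
    unfolding ua unfolding ca by (simp add: algebra_simps)
  finally have "cmod (1 - blaschke_factor a z) = (1 - cmod a) * (cmod (1 + u * z) / cmod (1 - cnj a * z))"
    using a by (simp only: norm_divide norm_mult norm_of_real) simp
  also have "\<dots> \<le> (1 - cmod a) * (2 / (1 - cmod z))"
  proof (intro mult_left_mono frac_le)
    show "cmod (1 + u * z) \<le> 2"
      using norm_triangle_ineq[of 1 "u * z"] z u by (simp add: norm_mult)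
    have "cmod (cnj a * z) \<le> cmod z" using a by (simp add: norm_mult mult_left_le_one_le)
    then show "1 - cmod z \<le> cmod (1 - cnj a * z)"
      using norm_triangle_ineq2[of 1 "cnj a * z"] by simp
  qed (use a z in auto)
  finally show ?thesis .
qed

lemma holomorphic_blaschke_factor:
  assumes "cmod a < 1"
  shows "blaschke_factor a holomorphic_on ball 0 1"
proof (cases "a = 0")
  case True
  then show ?thesis by (simp add: blaschke_factor_def[abs_def])
next
  case False
  then show ?thesis
    using one_minus_cnj_mult_nonzero[OF assms]
    by (auto simp: blaschke_factor_def[abs_def] intro!: holomorphic_intros)
qed

section \<open>Convergence and holomorphy of the infinite product\<close>

lemma cmod_prod_blaschke_le_1:
  assumes "A \<subseteq> ball 0 1" "cmod z < 1" "F \<subseteq> A"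
  shows "cmod (\<Prod>a\<in>F. blaschke_factor a z) \<le> 1"
  unfolding prod_norm[symmetric]
  using assms by (intro prod_le_1) (auto intro!: cmod_blaschke_factor_le_1)

lemma prod_blaschke_diff:
  assumes A: "A \<subseteq> ball 0 1" and z: "cmod z < 1" and FG: "finite G" "F \<subseteq> G" "G \<subseteq> A"
  shows "cmod ((\<Prod>a\<in>G. blaschke_factor a z) - (\<Prod>a\<in>F. blaschke_factor a z))
    \<le> (\<Sum>a\<in>G - F. 1 - cmod a) * (2 / (1 - cmod z))"
proof -
  let ?b = "\<lambda>a. blaschke_factor a z"
  have "(\<Prod>a\<in>G. ?b a) = (\<Prod>a\<in>F. ?b a) * (\<Prod>a\<in>G - F. ?b a)"
    using FG by (simp add: prod.subset_diff mult.commute)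
  then have "(\<Prod>a\<in>G. ?b a) - (\<Prod>a\<in>F. ?b a) = (\<Prod>a\<in>F. ?b a) * ((\<Prod>a\<in>G - F. ?b a) - (\<Prod>a\<in>G - F. 1))"
    by (simp add: algebra_simps)
  then have "cmod ((\<Prod>a\<in>G. ?b a) - (\<Prod>a\<in>F. ?b a)) \<le> cmod ((\<Prod>a\<in>G - F. ?b a) - (\<Prod>a\<in>G - F. 1))"
    using cmod_prod_blaschke_le_1[OF A z, of F] FG
    by (simp only: norm_mult) (intro mult_left_le_one_le, auto)
  also have "\<dots> \<le> (\<Sum>a\<in>G - F. cmod (?b a - 1))"
    using A z FG by (intro norm_prod_diff) (auto intro!: cmod_blaschke_factor_le_1)
  also have "\<dots> \<le> (\<Sum>a\<in>G - F. (1 - cmod a) * (2 / (1 - cmod z)))"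
    using A z FG cmod_one_minus_blaschke_factor
    by (intro sum_mono) (auto simp: norm_minus_commute[of _ 1])
  finally show ?thesis by (simp only: sum_distrib_right)
qed

text \<open>This is the Cauchy criterion for the unordered sum: the sums over \<open>G\<close> and
  \<open>F\<close> both lie within \<open>e/2\<close> of the total.\<close>

lemma blaschke_condition_tail:
  assumes A: "blaschke_condition A" and e: "e > 0"
  obtains F where "finite F" "F \<subseteq> A" "\<And>G. \<lbrakk>finite G; F \<subseteq> G; G \<subseteq> A\<rbrakk> \<Longrightarrow> (\<Sum>a\<in>G - F. 1 - cmod a) < e"
proof -
  obtain S where S: "((\<lambda>a. 1 - cmod a) has_sum S) A"
    using A by (auto simp: blaschke_condition_def summable_on_def)
  then have "\<forall>\<^sub>F F in finite_subsets_at_top A. dist (\<Sum>a\<in>F. 1 - cmod a) S < e/2"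
    unfolding has_sum_def using tendstoD[of _ S _ "e/2"] e by simp
  then obtain F where F: "finite F" "F \<subseteq> A"
    and FG: "\<And>G. \<lbrakk>finite G; F \<subseteq> G; G \<subseteq> A\<rbrakk> \<Longrightarrow> dist (\<Sum>a\<in>G. 1 - cmod a) S < e/2"
    unfolding eventually_finite_subsets_at_top by metis
  have "(\<Sum>a\<in>G - F. 1 - cmod a) < e" if G: "finite G" "F \<subseteq> G" "G \<subseteq> A" for G
    using FG[OF G] FG[OF F(1) order_refl F(2)] sum_diff[OF G(1,2), of "\<lambda>a. 1 - cmod a"]
    unfolding dist_real_def abs_less_iff by linarith
  then show ?thesis using that F by blast
qed

text \<open>The net of finite products is Cauchy, hence convergent, and uniqueness of limits
  identifies its limit with the \<open>Lim\<close> of the definition.\<close>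

lemma blaschke_product_tendsto:
  assumes A: "blaschke_condition A" and z: "cmod z < 1"
  shows "((\<lambda>F. \<Prod>a\<in>F. blaschke_factor a z) \<longlongrightarrow> blaschke_product A z) (finite_subsets_at_top A)"
proof -
  let ?P = "\<lambda>F. \<Prod>a\<in>F. blaschke_factor a z"
  have AD: "A \<subseteq> ball 0 1" using A by (simp add: blaschke_condition_def)
  have "cauchy_filter (filtermap ?P (finite_subsets_at_top A))"
    unfolding cauchy_filter_metric_filtermap
  proof (intro allI impI)
    fix e :: real assume e: "e > 0"
    \<comment> \<open>Multiplied by the factor \<open>2 / (1 - cmod z)\<close> of
      \<open>prod_blaschke_diff\<close>, this tail becomes \<open>e / 2\<close>.\<close>
    then have "e * (1 - cmod z) / 4 > 0" using z by simp
    then obtain F where F: "finite F" "F \<subseteq> A"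
      and FG: "\<And>G. \<lbrakk>finite G; F \<subseteq> G; G \<subseteq> A\<rbrakk> \<Longrightarrow> (\<Sum>a\<in>G - F. 1 - cmod a) < e * (1 - cmod z) / 4"
      using blaschke_condition_tail[OF A] by blast
    have near: "dist (?P G) (?P F) < e / 2" if G: "finite G" "F \<subseteq> G" "G \<subseteq> A" for G
    proof -
      have "dist (?P G) (?P F) \<le> (\<Sum>a\<in>G - F. 1 - cmod a) * (2 / (1 - cmod z))"
        unfolding dist_norm by (rule prod_blaschke_diff[OF AD z G])
      also have "\<dots> < e * (1 - cmod z) / 4 * (2 / (1 - cmod z))"
        using z by (intro mult_strict_right_mono FG[OF G]) auto
      also have "\<dots> = e / 2" using z by (simp add: field_simps)
      finally show ?thesis .
    qed
    show "\<exists>Q. eventually Q (finite_subsets_at_top A) \<and> (\<forall>x y. Q x \<and> Q y \<longrightarrow> dist (?P x) (?P y) < e)"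
    proof (intro exI conjI allI impI)
      show "\<forall>\<^sub>F G in finite_subsets_at_top A. finite G \<and> F \<subseteq> G \<and> G \<subseteq> A"
        unfolding eventually_finite_subsets_at_top using F by blast
      fix G H assume "(finite G \<and> F \<subseteq> G \<and> G \<subseteq> A) \<and> (finite H \<and> F \<subseteq> H \<and> H \<subseteq> A)"
      then show "dist (?P G) (?P H) < e"
        using near[of G] near[of H] dist_triangle_half_l[of "?P G" "?P F" e "?P H"] by blast
    qed
  qed
  then obtain L where L: "(?P \<longlongrightarrow> L) (finite_subsets_at_top A)"
    using cauchy_filter_convergent unfolding convergent_filter_iff filterlim_def by blast
  then show ?thesis
    unfolding blaschke_product_def by (subst tendsto_Lim[OF _ L]) auto
qed

lemma cmod_blaschke_product_le_1:
  assumes A: "blaschke_condition A" and z: "cmod z < 1"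
  shows "cmod (blaschke_product A z) \<le> 1"
proof (rule tendsto_upperbound[OF tendsto_norm[OF blaschke_product_tendsto[OF A z]]])
  show "\<forall>\<^sub>F F in finite_subsets_at_top A. cmod (\<Prod>a\<in>F. blaschke_factor a z) \<le> 1"
    using A by (intro eventually_finite_subsets_at_top_weakI cmod_prod_blaschke_le_1[OF _ z])
      (auto simp: blaschke_condition_def)
qed simp

lemma uniform_limit_blaschke_product:
  assumes A: "blaschke_condition A" and r: "r < 1"
  shows "uniform_limit (cball 0 r) (\<lambda>F z. \<Prod>a\<in>F. blaschke_factor a z) (blaschke_product A) (finite_subsets_at_top A)"
proof (rule uniform_limitI)
  fix e :: real assume e: "e > 0"
  have AD: "A \<subseteq> ball 0 1" using A by (simp add: blaschke_condition_def)
  \<comment> \<open>On the smaller disk \<open>2 / (1 - cmod z) \<le> 2 / (1 - r)\<close>, so one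
    set \<open>F\<close> serves all points. Each comparison with the product over \<open>F\<close>
    costs \<open>e / 4\<close>, and two of them stay below \<open>e\<close>.\<close>
  have "e * (1 - r) / 8 > 0" using e r by simp
  then obtain F where F: "finite F" "F \<subseteq> A"
    and FG: "\<And>G. \<lbrakk>finite G; F \<subseteq> G; G \<subseteq> A\<rbrakk> \<Longrightarrow> (\<Sum>a\<in>G - F. 1 - cmod a) < e * (1 - r) / 8"
    using blaschke_condition_tail[OF A] by blast
  have near: "dist (\<Prod>a\<in>G. blaschke_factor a z) (\<Prod>a\<in>F. blaschke_factor a z) \<le> e / 4"
    if G: "finite G" "F \<subseteq> G" "G \<subseteq> A" and z: "cmod z \<le> r" for G z
  proof -
    have z1: "cmod z < 1" using z r by simp
    have nn: "0 \<le> (\<Sum>a\<in>G - F. 1 - cmod a)"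
      using G AD by (intro sum_nonneg) (force simp: subset_iff less_imp_le)
    have "dist (\<Prod>a\<in>G. blaschke_factor a z) (\<Prod>a\<in>F. blaschke_factor a z)
        \<le> (\<Sum>a\<in>G - F. 1 - cmod a) * (2 / (1 - cmod z))"
      unfolding dist_norm by (rule prod_blaschke_diff[OF AD z1 G])
    also have "\<dots> \<le> e * (1 - r) / 8 * (2 / (1 - r))"
      using z r nn less_imp_le[OF FG[OF G]] e by (intro mult_mono frac_le) auto
    also have "\<dots> = e / 4" using r by (simp add: field_simps)
    finally show ?thesis .
  qed
  have lim: "dist (blaschke_product A z) (\<Prod>a\<in>F. blaschke_factor a z) \<le> e / 4" if z: "cmod z \<le> r" for z
  proof (rule tendsto_upperbound[OF tendsto_dist[OF blaschke_product_tendsto[OF A] tendsto_const]])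
    show "\<forall>\<^sub>F G in finite_subsets_at_top A.
        dist (\<Prod>a\<in>G. blaschke_factor a z) (\<Prod>a\<in>F. blaschke_factor a z) \<le> e / 4"
      unfolding eventually_finite_subsets_at_top by (intro exI[of _ F]) (use F near z in simp)
  qed (use z r in auto)
  have "dist (\<Prod>a\<in>G. blaschke_factor a z) (blaschke_product A z) < e"
    if G: "finite G" "F \<subseteq> G" "G \<subseteq> A" and z: "cmod z \<le> r" for G z
    using near[OF G z] lim[OF z] e
      dist_triangle2[of "\<Prod>a\<in>G. blaschke_factor a z" "blaschke_product A z" "\<Prod>a\<in>F. blaschke_factor a z"]
    by linarith
  then show "\<forall>\<^sub>F G in finite_subsets_at_top A.
      \<forall>z\<in>cball 0 r. dist (\<Prod>a\<in>G. blaschke_factor a z) (blaschke_product A z) < e"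
    unfolding eventually_finite_subsets_at_top using F by (intro exI[of _ F]) auto
qed

lemma holomorphic_blaschke_product:
  assumes A: "blaschke_condition A"
  shows "blaschke_product A holomorphic_on ball 0 1"
proof -
  have AD: "A \<subseteq> ball 0 1" using A by (simp add: blaschke_condition_def)
  have fin: "(\<lambda>z. \<Prod>a\<in>F. blaschke_factor a z) holomorphic_on ball 0 1" if "F \<subseteq> A" for F
    using AD that by (intro holomorphic_on_prod holomorphic_blaschke_factor) auto
  \<comment> \<open>Uniform convergence is available only on smaller closed disks; holomorphy is
    local, so these cover the unit disk.\<close>
  have loc: "blaschke_product A holomorphic_on ball 0 r" if r: "r < 1" for r
  proof (rule holomorphic_uniform_limit[OF _ uniform_limit_blaschke_product[OF A r]])
    have "cball 0 r \<subseteq> ball (0 :: complex) 1" "ball 0 r \<subseteq> ball (0 :: complex) 1" using r by auto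
    then show "\<forall>\<^sub>F F in finite_subsets_at_top A.
        continuous_on (cball 0 r) (\<lambda>z. \<Prod>a\<in>F. blaschke_factor a z) \<and>
        (\<lambda>z. \<Prod>a\<in>F. blaschke_factor a z) holomorphic_on ball 0 r"
      using holomorphic_on_subset[OF fin] holomorphic_on_imp_continuous_on
      by (intro eventually_finite_subsets_at_top_weakI) blast
  qed auto
  show ?thesis
  proof (subst holomorphic_on_open, simp, intro ballI)
    fix z :: complex assume "z \<in> ball 0 1"
    then obtain r where "cmod z < r" "r < 1" using dense by auto
    with loc[of r] show "\<exists>D. (blaschke_product A has_field_derivative D) (at z)"
      by (subst (asm) holomorphic_on_open) auto
  qed
qed

lemma blaschke_product_zero:
  assumes A: "blaschke_condition A" and a: "a \<in> A"
  shows "blaschke_product A a = 0"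
proof -
  have a1: "cmod a < 1" using A a by (auto simp: blaschke_condition_def)
  have "\<forall>\<^sub>F F in finite_subsets_at_top A. (\<Prod>c\<in>F. blaschke_factor c a) = 0"
    unfolding eventually_finite_subsets_at_top
  proof (intro exI[of _ "{a}"] conjI allI impI)
    fix F assume F: "finite F \<and> {a} \<subseteq> F \<and> F \<subseteq> A"
    have "blaschke_factor a a = 0" by (simp add: blaschke_factor_def)
    then show "(\<Prod>c\<in>F. blaschke_factor c a) = 0" using F by (intro prod_zero) auto
  qed (use a in auto)
  then have "((\<lambda>F. \<Prod>c\<in>F. blaschke_factor c a) \<longlongrightarrow> 0) (finite_subsets_at_top A)"
    by (rule tendsto_eventually)
  then show ?thesis
    using tendsto_unique[OF _ blaschke_product_tendsto[OF A a1]] by auto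
qed

section \<open>Disjoint unions, and a lower bound away from the zeros\<close>

lemma blaschke_condition_Un:
  "\<lbrakk>blaschke_condition A; blaschke_condition B; A \<inter> B = {}\<rbrakk> \<Longrightarrow> blaschke_condition (A \<union> B)"
  by (simp add: blaschke_condition_def summable_on_Un_disjoint)

lemma blaschke_product_Un:
  assumes A: "blaschke_condition A" and B: "blaschke_condition B" and AB: "A \<inter> B = {}"
    and z: "cmod z < 1"
  shows "blaschke_product (A \<union> B) z = blaschke_product A z * blaschke_product B z"
proof (rule tendsto_unique)
  let ?P = "\<lambda>F. \<Prod>a\<in>F. blaschke_factor a z"
  show "(?P \<longlongrightarrow> blaschke_product (A \<union> B) z) (finite_subsets_at_top (A \<union> B))"
    by (rule blaschke_product_tendsto[OF blaschke_condition_Un[OF A B AB] z])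
  \<comment> \<open>As \<open>F\<close> exhausts the union, its intersections with the two parts
    exhaust these parts, so the two subproducts converge separately.\<close>
  have "filterlim (\<lambda>F. F \<inter> A) (finite_subsets_at_top A) (finite_subsets_at_top (A \<union> B))"
    "filterlim (\<lambda>F. F \<inter> B) (finite_subsets_at_top B) (finite_subsets_at_top (A \<union> B))"
    unfolding filterlim_finite_subsets_at_top eventually_finite_subsets_at_top by blast+
  then have "((\<lambda>F. ?P (F \<inter> A) * ?P (F \<inter> B)) \<longlongrightarrow> blaschke_product A z * blaschke_product B z)
      (finite_subsets_at_top (A \<union> B))"
    by (intro tendsto_mult filterlim_compose[OF blaschke_product_tendsto[OF A z]]
        filterlim_compose[OF blaschke_product_tendsto[OF B z]])
  moreover have "?P (F \<inter> A) * ?P (F \<inter> B) = ?P F" if "finite F" "F \<subseteq> A \<union> B" for F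
  proof -
    have "F = (F \<inter> A) \<union> (F \<inter> B)" using that by blast
    then have "?P F = ?P ((F \<inter> A) \<union> (F \<inter> B))" by simp
    also have "\<dots> = ?P (F \<inter> A) * ?P (F \<inter> B)"
      using that AB by (intro prod.union_disjoint) auto
    finally show ?thesis by simp
  qed
  ultimately show "(?P \<longlongrightarrow> blaschke_product A z * blaschke_product B z) (finite_subsets_at_top (A \<union> B))"
    by (rule Lim_transform_eventually[OF _ eventually_finite_subsets_at_top_weakI])
qed simp

lemma one_minus_cmod_blaschke_product_sq:
  assumes A: "blaschke_condition A" and z: "cmod z < 1" and d: "d > 0" "\<And>a. a \<in> A \<Longrightarrow> d \<le> cmod (a - z)"
  shows "1 - (cmod (blaschke_product A z))\<^sup>2 \<le> (1 - (cmod z)\<^sup>2) * (2 * (\<Sum>\<^sub>\<infinity>a\<in>A. 1 - cmod a) / d\<^sup>2)"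
proof (rule tendsto_upperbound)
  let ?P = "\<lambda>F. \<Prod>a\<in>F. blaschke_factor a z"
  have AD: "A \<subseteq> ball 0 1" and sum: "(\<lambda>a. 1 - cmod a) summable_on A"
    using A by (auto simp: blaschke_condition_def)
  show "((\<lambda>F. 1 - (cmod (?P F))\<^sup>2) \<longlongrightarrow> 1 - (cmod (blaschke_product A z))\<^sup>2) (finite_subsets_at_top A)"
    by (intro tendsto_intros blaschke_product_tendsto A z)
  have z2: "1 - (cmod z)\<^sup>2 \<ge> 0" using z by (simp add: power_le_one)
  have "1 - (cmod (?P F))\<^sup>2 \<le> (1 - (cmod z)\<^sup>2) * (2 * (\<Sum>\<^sub>\<infinity>a\<in>A. 1 - cmod a) / d\<^sup>2)"
    if F: "finite F" "F \<subseteq> A" for F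
  proof -
    have bound: "1 - (cmod (blaschke_factor a z))\<^sup>2 \<le> (1 - cmod a) * (2 * (1 - (cmod z)\<^sup>2) / d\<^sup>2)"
      if a: "a \<in> F" for a
    proof -
      have a1: "cmod a < 1" using a F AD by auto
      have "d\<^sup>2 \<le> (cmod (a - z))\<^sup>2" using d a F by (intro power_mono) auto
      \<comment> \<open>The distance from \<open>z\<close> to the zeros thus bounds the denominator
        of the defect from below.\<close>
      also have "\<dots> \<le> (cmod (1 - cnj a * z))\<^sup>2"
      proof -
        have "0 \<le> (1 - (cmod a)\<^sup>2) * (1 - (cmod z)\<^sup>2)"
          using a1 z2 by (simp add: power_le_one)
        then show ?thesis unfolding cmod_one_minus_cnj_mult_sq[symmetric] by simp
      qed
      finally have den: "d\<^sup>2 \<le> (cmod (1 - cnj a * z))\<^sup>2" .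
      have "1 - (cmod a)\<^sup>2 = (1 - cmod a) * (1 + cmod a)"
        by (simp add: power2_eq_square algebra_simps)
      also have "\<dots> \<le> (1 - cmod a) * 2" using a1 by (intro mult_left_mono) auto
      finally have num: "1 - (cmod a)\<^sup>2 \<le> (1 - cmod a) * 2" .
      have "1 - (cmod (blaschke_factor a z))\<^sup>2 \<le> (1 - cmod a) * 2 * (1 - (cmod z)\<^sup>2) / d\<^sup>2"
        unfolding one_minus_cmod_blaschke_factor_sq[OF a1 z]
        using a1 z2 d den num by (intro frac_le mult_right_mono mult_nonneg_nonneg) auto
      then show ?thesis by (simp only: times_divide_eq_right mult.assoc)
    qed
    have "1 - (cmod (?P F))\<^sup>2 = 1 - (\<Prod>a\<in>F. (cmod (blaschke_factor a z))\<^sup>2)"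
      by (simp only: prod_norm[symmetric] prod_power_distrib)
    \<comment> \<open>For numbers in the unit interval, one minus a product is at most the sum of
      the individual defects.\<close>
    also have "\<dots> \<le> norm ((\<Prod>a\<in>F. 1) - (\<Prod>a\<in>F. (cmod (blaschke_factor a z))\<^sup>2))" by simp
    also have "\<dots> \<le> (\<Sum>a\<in>F. norm (1 - (cmod (blaschke_factor a z))\<^sup>2))"
      using F AD z by (intro norm_prod_diff) (auto simp: abs_square_le_1 intro!: cmod_blaschke_factor_le_1)
    also have "\<dots> = (\<Sum>a\<in>F. 1 - (cmod (blaschke_factor a z))\<^sup>2)"
      using F AD z cmod_blaschke_factor_le_1 by (intro sum.cong) (auto simp: power_le_one subset_iff)
    also have "\<dots> \<le> (\<Sum>a\<in>F. (1 - cmod a) * (2 * (1 - (cmod z)\<^sup>2) / d\<^sup>2))"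
      by (rule sum_mono[OF bound])
    also have "\<dots> = (\<Sum>a\<in>F. 1 - cmod a) * (2 * (1 - (cmod z)\<^sup>2) / d\<^sup>2)"
      by (simp only: sum_distrib_right)
    also have "\<dots> \<le> (\<Sum>\<^sub>\<infinity>a\<in>A. 1 - cmod a) * (2 * (1 - (cmod z)\<^sup>2) / d\<^sup>2)"
      using AD z2 F by (intro mult_right_mono finite_sum_le_infsum sum) (auto simp: subset_iff less_imp_le)
    finally show ?thesis by (simp only: times_divide_eq_right mult_ac)
  qed
  then show "\<forall>\<^sub>F F in finite_subsets_at_top A. 1 - (cmod (?P F))\<^sup>2
      \<le> (1 - (cmod z)\<^sup>2) * (2 * (\<Sum>\<^sub>\<infinity>a\<in>A. 1 - cmod a) / d\<^sup>2)"
    by (intro eventually_finite_subsets_at_top_weakI)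
qed simp

section \<open>Projections to model spaces\<close>

lemma hardy2_blaschke_mult:
  assumes "blaschke_condition A" "h \<in> hardy2"
  shows "(\<lambda>z. blaschke_product A z * h z) \<in> hardy2"
    and "hardy2_norm (\<lambda>z. blaschke_product A z * h z) \<le> hardy2_norm h"
  using hardy2_mult_contraction[OF holomorphic_blaschke_product cmod_blaschke_product_le_1] assms by auto

lemma blaschke_multiples_subset:
  "blaschke_condition A \<Longrightarrow> (\<lambda>h z. blaschke_product A z * h z) ` hardy2 \<subseteq> hardy2"
  using hardy2_blaschke_mult(1) by blast

lemma hardy2_subspace_model_space: "blaschke_condition A \<Longrightarrow> hardy2_subspace (model_space A)"
  unfolding model_space_def
  by (intro hardy2_subspace_ominus hardy2_subspace_hardy2 blaschke_multiples_subset)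

lemma model_space_proj_exists:
  assumes "blaschke_condition A" "f \<in> hardy2"
  shows "\<exists>g\<in>model_space A. \<forall>h\<in>model_space A. hardy2_inner (\<lambda>z. f z - g z) h = 0"
  using hardy2_proj_exists[OF blaschke_multiples_subset] assms unfolding model_space_def by blast

lemma model_space_orthogonal:
  "\<lbrakk>f \<in> model_space A; h \<in> hardy2\<rbrakk> \<Longrightarrow> hardy2_inner f (\<lambda>z. blaschke_product A z * h z) = 0"
  by (auto simp: model_space_def hardy2_ominus_def)

text \<open>A multiple of the larger Blaschke product is a multiple of the one for \<open>A\<close>,
  because the factor belonging to \<open>B\<close> can be absorbed into the Hardy function.\<close>

lemma model_space_mono:
  assumes A: "blaschke_condition A" and B: "blaschke_condition B" and AB: "A \<inter> B = {}"
  shows "model_space A \<subseteq> model_space (A \<union> B)"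
proof
  fix f assume f: "f \<in> model_space A"
  have "hardy2_inner f (\<lambda>z. blaschke_product (A \<union> B) z * h z) = 0" if h: "h \<in> hardy2" for h
  proof -
    \<comment> \<open>The factorization is known only in the disk; off the disk both sides vanish
      with \<open>h\<close>.\<close>
    have "(\<lambda>z. blaschke_product (A \<union> B) z * h z) = (\<lambda>z. blaschke_product A z * (blaschke_product B z * h z))"
    proof
      fix z
      show "blaschke_product (A \<union> B) z * h z = blaschke_product A z * (blaschke_product B z * h z)"
      proof (cases "z \<in> ball 0 1")
        case True
        then show ?thesis using blaschke_product_Un[OF A B AB, of z] by simp
      next
        case False
        then show ?thesis using hardy2_off_disk[OF h False] by simp
      qed
    qed
    then show ?thesis
      using model_space_orthogonal[OF f hardy2_blaschke_mult(1)[OF B h]] by simp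
  qed
  then show "f \<in> model_space (A \<union> B)"
    using f unfolding model_space_def hardy2_ominus_def by blast
qed

text \<open>Pairing a multiple of the Blaschke product with \<open>k\<close> evaluates it at its
  zero \<open>b\<close>.\<close>

lemma reproducing_kernel_in_model_space:
  assumes B: "blaschke_condition B" and b: "b \<in> B" and k: "k \<in> hardy2"
    and repr: "\<And>f. f \<in> hardy2 \<Longrightarrow> hardy2_inner f k = f b"
  shows "k \<in> model_space B"
proof -
  have "hardy2_inner k (\<lambda>z. blaschke_product B z * h z) = 0" if h: "h \<in> hardy2" for h
    using hardy2_inner_commute[OF hardy2_blaschke_mult(1)[OF B h] k]
      repr[OF hardy2_blaschke_mult(1)[OF B h]] blaschke_product_zero[OF B b] by simp
  then show ?thesis using k by (auto simp: model_space_def hardy2_ominus_def)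
qed

text \<open>With \<open>p\<close> the projection of \<open>x\<close> to the model space of
  \<open>A\<close>, the second conclusion holds because \<open>u = x - p\<close> is orthogonal to
  \<open>p\<close>, and the third because \<open>p\<close> is orthogonal to every multiple of the
  Blaschke product.\<close>

lemma proj_zero_space:
  assumes A: "blaschke_condition A" and B: "blaschke_condition B" and AB: "A \<inter> B = {}"
    and x: "x \<in> model_space (A \<union> B)"
  defines "u \<equiv> hardy2_proj (zero_space A B) x"
  shows "u \<in> hardy2"
    and "hardy2_inner u x = of_real ((hardy2_norm u)\<^sup>2)"
    and "h \<in> hardy2 \<Longrightarrow> hardy2_inner u (\<lambda>z. blaschke_product A z * h z)
           = hardy2_inner x (\<lambda>z. blaschke_product A z * h z)"
proof -
  note subA = hardy2_subspace_model_space[OF A]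
  note subAB = hardy2_subspace_model_space[OF blaschke_condition_Un[OF A B AB]]
  have xH: "x \<in> hardy2" by (rule hardy2_subspaceD(1)[OF subAB x])
  obtain p where p: "p \<in> model_space A"
    and orth: "\<And>h. h \<in> model_space A \<Longrightarrow> hardy2_inner (\<lambda>z. x z - p z) h = 0"
    using model_space_proj_exists[OF A xH] by blast
  have pH: "p \<in> hardy2" by (rule hardy2_subspaceD(1)[OF subA p])
  have subZ: "hardy2_subspace (zero_space A B)"
    unfolding zero_space_def
    by (rule hardy2_subspace_ominus[OF subAB]) (use hardy2_subspaceD(1)[OF subA] in blast)
  have diffZ: "(\<lambda>z. x z - p z) \<in> zero_space A B"
    unfolding zero_space_def hardy2_ominus_def
    using hardy2_subspaceD(2)[OF subAB x] model_space_mono[OF A B AB] p orth by blast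
  \<comment> \<open>The existence result concerns complements in all of \<open>hardy2\<close>; in
    this relative complement the projection is exhibited and then identified by uniqueness.\<close>
  have u: "u = (\<lambda>z. x z - p z)"
    unfolding u_def
  proof (rule hardy2_proj_eqI[OF subZ xH diffZ])
    fix h assume h: "h \<in> zero_space A B"
    have "h \<in> hardy2" by (rule hardy2_subspaceD(1)[OF subZ h])
    moreover have "hardy2_inner h p = 0" using h p by (simp add: zero_space_def hardy2_ominus_def)
    ultimately show "hardy2_inner (\<lambda>z. x z - (x z - p z)) h = 0"
      using hardy2_inner_commute[of h p] pH by simp
  qed
  show uH: "u \<in> hardy2" unfolding u by (rule hardy2_diff[OF xH pH])
  have "hardy2_inner u u = hardy2_inner u x - hardy2_inner u p"
    by (subst (2) u) (rule hardy2_inner_diff_right[OF xH pH uH])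
  moreover have "hardy2_inner u p = 0" unfolding u by (rule orth[OF p])
  ultimately show "hardy2_inner u x = of_real ((hardy2_norm u)\<^sup>2)"
    using hardy2_inner_self_norm[OF uH] by simp
  assume h: "h \<in> hardy2"
  show "hardy2_inner u (\<lambda>z. blaschke_product A z * h z) = hardy2_inner x (\<lambda>z. blaschke_product A z * h z)"
    unfolding u using model_space_orthogonal[OF p h] hardy2_blaschke_mult(1)[OF A h]
    by (simp add: hardy2_inner_diff_left xH pH)
qed

text \<open>The residual is orthogonal to the model space, so the projection can be removed when
  pairing with an element of that space.\<close>

lemma proj_model_space:
  assumes B: "blaschke_condition B" and u: "u \<in> hardy2"
  shows "hardy2_proj (model_space B) u \<in> hardy2"
    and "x \<in> model_space B \<Longrightarrow> hardy2_inner (hardy2_proj (model_space B) u) x = hardy2_inner u x"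
proof -
  note sub = hardy2_subspace_model_space[OF B]
  obtain p where p: "p \<in> model_space B"
    and orth: "\<And>h. h \<in> model_space B \<Longrightarrow> hardy2_inner (\<lambda>z. u z - p z) h = 0"
    using model_space_proj_exists[OF B u] by blast
  have eq: "hardy2_proj (model_space B) u = p"
    by (rule hardy2_proj_eqI[OF sub u p orth])
  show pH: "hardy2_proj (model_space B) u \<in> hardy2"
    unfolding eq by (rule hardy2_subspaceD(1)[OF sub p])
  assume x: "x \<in> model_space B"
  show "hardy2_inner (hardy2_proj (model_space B) u) x = hardy2_inner u x"
    using orth[OF x] hardy2_inner_diff_left[OF u pH[unfolded eq] hardy2_subspaceD(1)[OF sub x]]
    unfolding eq by simp
qed

section \<open>Weak convergence and normalized kernels\<close>

lemma hardy2_weakly_null: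
  assumes g: "g \<in> hardy2" and X: "\<And>n. X n \<in> hardy2" "\<And>n. hardy2_norm (X n) \<le> 1"
    and coeff: "\<And>k. (\<lambda>n. taylor_coeff (X n) k) \<longlonglongrightarrow> 0"
  shows "(\<lambda>n. hardy2_inner g (X n)) \<longlonglongrightarrow> 0"
proof (rule LIMSEQ_I)
  fix e :: real assume e: "e > 0"
  let ?g = "taylor_coeff g"
  note gs = hardy2_summable[OF g]
  \<comment> \<open>Beyond \<open>N\<close> the coefficients of \<open>g\<close> have small l2 norm,
    so Cauchy-Schwarz bounds the tail uniformly in \<open>n\<close>. The finitely many remaining
    terms tend to zero one by one.\<close>
  obtain N where N: "(\<Sum>k. (cmod (?g (k + N)))\<^sup>2) < (e/2)\<^sup>2"
  proof -
    from suminf_exist_split[OF _ gs, of "(e/2)\<^sup>2"] e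
    obtain N where "norm (\<Sum>k. (cmod (?g (k + N)))\<^sup>2) < (e/2)\<^sup>2" by auto
    then have "(\<Sum>k. (cmod (?g (k + N)))\<^sup>2) < (e/2)\<^sup>2" by simp
    then show thesis by (rule that)
  qed
  have gN: "summable (\<lambda>k. (cmod (?g (k + N)))\<^sup>2)"
    by (rule summable_ignore_initial_segment[OF gs])
  have tail: "cmod (\<Sum>k. ?g (k + N) * cnj (taylor_coeff (X n) (k + N))) \<le> e/2" for n
  proof -
    note xs = hardy2_summable[OF X(1)[of n]]
    have xN: "summable (\<lambda>k. (cmod (taylor_coeff (X n) (k + N)))\<^sup>2)"
      by (rule summable_ignore_initial_segment[OF xs])
    have "(\<Sum>k. (cmod (taylor_coeff (X n) (k + N)))\<^sup>2) \<le> (\<Sum>k. (cmod (taylor_coeff (X n) k))\<^sup>2)"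
      using suminf_split_initial_segment[OF xs, of N]
        sum_nonneg[of "{..<N}" "\<lambda>k. (cmod (taylor_coeff (X n) k))\<^sup>2"] by simp
    also have "\<dots> \<le> 1"
      using X(2)[of n] hardy2_norm_nonneg[OF X(1)[of n]]
      by (simp add: hardy2_norm_sq[OF X(1), symmetric] power_le_one)
    finally have x1: "(\<Sum>k. (cmod (taylor_coeff (X n) (k + N)))\<^sup>2) \<le> 1" .
    note s = l2_mult_summable[OF gN xN]
    have "cmod (\<Sum>k. ?g (k + N) * cnj (taylor_coeff (X n) (k + N)))
        \<le> (\<Sum>k. cmod (?g (k + N)) * cmod (taylor_coeff (X n) (k + N)))"
      using summable_norm[of "\<lambda>k. ?g (k + N) * cnj (taylor_coeff (X n) (k + N))"] s(1)
      by (simp add: norm_mult)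
    also note s(2)
    also have "sqrt (\<Sum>k. (cmod (?g (k + N)))\<^sup>2) * sqrt (\<Sum>k. (cmod (taylor_coeff (X n) (k + N)))\<^sup>2) \<le> e/2 * 1"
    proof (rule mult_mono)
      show "sqrt (\<Sum>k. (cmod (?g (k + N)))\<^sup>2) \<le> e/2"
        using real_sqrt_le_mono[OF less_imp_le[OF N]] e by simp
    qed (use x1 e in \<open>auto intro: suminf_nonneg xN\<close>)
    finally show ?thesis by simp
  qed
  have "(\<lambda>n. \<Sum>k<N. ?g k * cnj (taylor_coeff (X n) k)) \<longlonglongrightarrow> (\<Sum>k<N. ?g k * cnj 0)"
    by (intro tendsto_intros coeff)
  then have "(\<lambda>n. \<Sum>k<N. ?g k * cnj (taylor_coeff (X n) k)) \<longlonglongrightarrow> 0" by simp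
  from LIMSEQ_D[OF this, of "e/2"] e
  obtain M where M: "\<And>n. n \<ge> M \<Longrightarrow> cmod (\<Sum>k<N. ?g k * cnj (taylor_coeff (X n) k)) < e/2" by auto
  have "norm (hardy2_inner g (X n) - 0) < e" if "n \<ge> M" for n
  proof -
    have "hardy2_inner g (X n) = (\<Sum>k. ?g (k + N) * cnj (taylor_coeff (X n) (k + N)))
        + (\<Sum>k<N. ?g k * cnj (taylor_coeff (X n) k))"
      unfolding hardy2_inner_def by (rule suminf_split_initial_segment[OF hardy2_inner_summable[OF g X(1)]])
    then show ?thesis
      using tail[of n] M[OF that]
        norm_triangle_ineq[of "\<Sum>k. ?g (k + N) * cnj (taylor_coeff (X n) (k + N))"
          "\<Sum>k<N. ?g k * cnj (taylor_coeff (X n) k)"]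
      by simp
  qed
  then show "\<exists>M. \<forall>n\<ge>M. norm (hardy2_inner g (X n) - 0) < e" by blast
qed

lemma blaschke_condition_enum:
  assumes B: "blaschke_condition B" and b: "bij_betw b (UNIV :: nat set) B"
  shows "(\<lambda>j. cmod (b j)) \<longlonglongrightarrow> 1"
proof -
  have "(\<lambda>j. 1 - cmod (b j)) summable_on UNIV"
    using B summable_on_reindex_bij_betw[OF b, of "\<lambda>a. 1 - cmod a"] by (simp add: blaschke_condition_def)
  then have "(\<lambda>j. 1 - cmod (b j)) \<longlonglongrightarrow> 0"
    by (intro summable_LIMSEQ_zero summable_on_imp_summable)
  from tendsto_diff[OF tendsto_const[of 1] this] show ?thesis by simp
qed

text \<open>The coefficient bound is uniform in the index and tends to zero as \<open>b\<close>
  approaches the circle, which makes these unit vectors weakly null. The last bound is what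
  compactness will be played against.\<close>

lemma normalized_kernel:
  assumes A: "blaschke_condition A" and B: "blaschke_condition B" and AB: "A \<inter> B = {}" and b: "b \<in> B"
  obtains x where "x \<in> model_space B" "hardy2_norm x = 1"
    "\<And>n. cmod (taylor_coeff x n) \<le> sqrt (1 - (cmod b)\<^sup>2)"
    "(hardy2_proj (model_space B) \<circ> hardy2_proj (zero_space A B)) x \<in> hardy2"
    "(cmod (blaschke_product A b))\<^sup>2
      \<le> cmod (hardy2_inner ((hardy2_proj (model_space B) \<circ> hardy2_proj (zero_space A B)) x) x)"
proof -
  have b1: "cmod b < 1" using B b by (auto simp: blaschke_condition_def)
  then have b2: "(cmod b)\<^sup>2 < 1" by (simp add: abs_square_less_1)
  obtain k where k: "k \<in> hardy2" "\<And>n. taylor_coeff k n = cnj b ^ n"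
    and repr: "\<And>f. f \<in> hardy2 \<Longrightarrow> hardy2_inner f k = f b"
    and norm_k: "(hardy2_norm k)\<^sup>2 = 1 / (1 - (cmod b)\<^sup>2)"
    using hardy2_kernel[OF b1] by blast
  define c where "c = sqrt (1 - (cmod b)\<^sup>2)"
  have c: "c > 0" "c\<^sup>2 = 1 - (cmod b)\<^sup>2" using b2 by (auto simp: c_def)
  have nk: "hardy2_norm k = 1 / c"
    using norm_k c hardy2_norm_nonneg[OF k(1)] power2_eq_imp_eq[of "hardy2_norm k" "1 / c"]
    by (simp add: power_divide)
  define x where "x = (\<lambda>z. of_real c * k z)"
  note subB = hardy2_subspace_model_space[OF B]
  have kB: "k \<in> model_space B" by (rule reproducing_kernel_in_model_space[OF B b k(1) repr])
  have xB: "x \<in> model_space B" unfolding x_def by (rule hardy2_subspaceD(3)[OF subB kB])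
  note xH = hardy2_subspaceD(1)[OF subB xB]
  have nx: "hardy2_norm x = 1"
    using c(1) by (simp add: x_def hardy2_norm_cmult[OF k(1)] nk)
  have cx: "cmod (taylor_coeff x n) \<le> sqrt (1 - (cmod b)\<^sup>2)" for n
  proof -
    have "cmod (taylor_coeff x n) = c * cmod b ^ n"
      using c(1) by (simp add: x_def taylor_coeff_cmult[OF hardy2_holomorphic[OF k(1)]] k(2) norm_mult norm_power)
    also have "\<dots> \<le> c * 1" using c(1) b1 by (intro mult_left_mono power_le_one) auto
    finally show ?thesis by (simp add: c_def)
  qed
  \<comment> \<open>Inclusion of model spaces is applied with the two sets exchanged, since
    \<open>x\<close> comes from the one for \<open>B\<close>.\<close>
  have xAB: "x \<in> model_space (A \<union> B)"
    using model_space_mono[OF B A] AB xB by (auto simp: Un_commute Int_commute)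
  define u where "u = hardy2_proj (zero_space A B) x"
  note uH = proj_zero_space(1)[OF A B AB xAB, folded u_def]
    and ux = proj_zero_space(2)[OF A B AB xAB, folded u_def]
    and uh = proj_zero_space(3)[OF A B AB xAB, folded u_def]
  note th = hardy2_blaschke_mult[OF A xH]
  \<comment> \<open>Pairing with \<open>x\<close> is evaluation at \<open>b\<close> times
    \<open>c\<close>. Applied to \<open>x\<close> itself this gives \<open>c * x b = 1\<close>, so
    the normalization cancels.\<close>
  have "blaschke_product A b = hardy2_inner (\<lambda>z. blaschke_product A z * x z) x"
  proof -
    have "hardy2_inner (\<lambda>z. blaschke_product A z * x z) x = blaschke_product A b * (of_real c * x b)"
      using repr[OF th(1)] hardy2_inner_cmult_right[OF k(1) th(1), of "of_real c"] by (simp add: x_def)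
    also have "of_real c * x b = hardy2_inner x x"
      using repr[OF xH] hardy2_inner_cmult_right[OF k(1) xH, of "of_real c"] by (simp add: x_def)
    finally show ?thesis using hardy2_inner_self_norm[OF xH] nx by simp
  qed
  then have "cmod (blaschke_product A b) = cmod (hardy2_inner x (\<lambda>z. blaschke_product A z * x z))"
    using hardy2_inner_commute[OF xH th(1)] by simp
  also have "\<dots> = cmod (hardy2_inner u (\<lambda>z. blaschke_product A z * x z))"
    by (simp only: uh[OF xH])
  also have "\<dots> \<le> hardy2_norm u * hardy2_norm (\<lambda>z. blaschke_product A z * x z)"
    by (rule hardy2_Cauchy_Schwarz[OF uH th(1)])
  also have "\<dots> \<le> hardy2_norm u * 1"
    using th(2) nx by (intro mult_left_mono hardy2_norm_nonneg uH) simp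
  finally have "(cmod (blaschke_product A b))\<^sup>2 \<le> (hardy2_norm u)\<^sup>2"
    by (intro power_mono) auto
  also have "\<dots> = cmod (hardy2_inner (hardy2_proj (model_space B) u) x)"
    unfolding proj_model_space(2)[OF B uH xB] ux norm_of_real by simp
  finally show ?thesis
    using that[OF xB nx cx] proj_model_space(1)[OF B uH] by (simp add: u_def)
qed

theorem proposition5p9:
  fixes A B :: "complex set" and b :: "nat \<Rightarrow> complex"
  assumes "infinite A" and "infinite B" and "A \<inter> B = {}"
    and "blaschke_condition A" and "blaschke_condition B"
    and "bij_betw b UNIV B"
    and "hardy2_compact_operator (hardy2_proj (model_space B) \<circ> hardy2_proj (zero_space A B))"
  shows "(\<lambda>j. blaschke_product A (b j)) \<longlonglongrightarrow> 0 \<and> limit_set B \<subseteq> limit_set A"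
proof
  note AB = assms(3) and A = assms(4) and B = assms(5) and b = assms(6)
  let ?T = "hardy2_proj (model_space B) \<circ> hardy2_proj (zero_space A B)"
  let ?\<theta> = "\<lambda>j. blaschke_product A (b j)"
  have bB: "b j \<in> B" for j using b by (auto simp: bij_betw_def)
  have b1: "cmod (b j) < 1" for j using bB[of j] B by (auto simp: blaschke_condition_def)
  note b_lim = blaschke_condition_enum[OF B b]
  have "\<exists>x. x \<in> model_space B \<and> hardy2_norm x = 1 \<and>
      (\<forall>n. cmod (taylor_coeff x n) \<le> sqrt (1 - (cmod (b j))\<^sup>2)) \<and> ?T x \<in> hardy2 \<and>
      (cmod (?\<theta> j))\<^sup>2 \<le> cmod (hardy2_inner (?T x) x)" for j
    by (rule normalized_kernel[OF A B AB bB[of j]]) blast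
  then obtain x where xB: "\<And>j. x j \<in> model_space B" and nx: "\<And>j. hardy2_norm (x j) = 1"
    and cx: "\<And>j n. cmod (taylor_coeff (x j) n) \<le> sqrt (1 - (cmod (b j))\<^sup>2)"
    and Tx: "\<And>j. ?T (x j) \<in> hardy2"
    and low: "\<And>j. (cmod (?\<theta> j))\<^sup>2 \<le> cmod (hardy2_inner (?T (x j)) (x j))"
    by metis
  have xH: "x j \<in> hardy2" for j
    by (rule hardy2_subspaceD(1)[OF hardy2_subspace_model_space[OF B] xB])
  have "(\<lambda>j. sqrt (1 - (cmod (b j))\<^sup>2)) \<longlonglongrightarrow> sqrt (1 - 1\<^sup>2)"
    by (intro tendsto_intros b_lim)
  then have coeff: "(\<lambda>j. taylor_coeff (x j) n) \<longlonglongrightarrow> 0" for n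
    using cx by (intro Lim_null_comparison[of "\<lambda>j. taylor_coeff (x j) n" "\<lambda>j. sqrt (1 - (cmod (b j))\<^sup>2)"]) auto
  show lim0: "?\<theta> \<longlonglongrightarrow> 0"
  proof (rule ccontr)
    assume "\<not> ?\<theta> \<longlonglongrightarrow> 0"
    then obtain e where e: "e > 0" and "\<not> (\<forall>\<^sub>F j in sequentially. dist (?\<theta> j) 0 < e)"
      unfolding tendsto_iff by blast
    \<comment> \<open>Failing to hold eventually along the naturals means failing infinitely often,
      which provides a subsequence bounded away from zero.\<close>
    then have "infinite {j. e \<le> cmod (?\<theta> j)}"
      unfolding cofinite_eq_sequentially[symmetric] by (simp add: eventually_cofinite not_less)
    then obtain s :: "nat \<Rightarrow> nat" where s: "strict_mono s" and se: "\<And>n. e \<le> cmod (?\<theta> (s n))"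
      using infinite_enumerate[of "{j. e \<le> cmod (?\<theta> j)}"] by auto
    have "(\<forall>n. x (s n) \<in> hardy2) \<and> (\<exists>C. \<forall>n. hardy2_norm (x (s n)) \<le> C)"
      using xH nx by (auto intro!: exI[of _ 1])
    then obtain r :: "nat \<Rightarrow> nat" and g where r: "strict_mono r" and g: "g \<in> hardy2"
      and conv: "(\<lambda>n. hardy2_norm (\<lambda>z. ?T (x (s (r n))) z - g z)) \<longlonglongrightarrow> 0"
      using assms(7)[unfolded hardy2_compact_operator_def, rule_format, of "\<lambda>n. x (s n)"] by blast
    define X where "X n = x (s (r n))" for n
    have sub: "strict_mono (s \<circ> r)" using s r by (rule strict_mono_o)
    have "(\<lambda>n. hardy2_inner g (X n)) \<longlonglongrightarrow> 0"
    proof (rule hardy2_weakly_null[OF g])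
      show "(\<lambda>n. taylor_coeff (X n) k) \<longlonglongrightarrow> 0" for k
        using LIMSEQ_subseq_LIMSEQ[OF coeff[of k] sub] by (simp add: o_def X_def)
    qed (simp_all add: X_def xH nx)
    then have "(\<lambda>n. hardy2_norm (\<lambda>z. ?T (X n) z - g z) + cmod (hardy2_inner g (X n))) \<longlonglongrightarrow> 0 + 0"
      using conv by (intro tendsto_add tendsto_norm_zero) (simp_all add: X_def)
    \<comment> \<open>The pairing of the image with \<open>X n\<close> is split at the limit
      \<open>g\<close>: norm convergence controls the first part, weak nullity the second.\<close>
    moreover have "e\<^sup>2 \<le> hardy2_norm (\<lambda>z. ?T (X n) z - g z) + cmod (hardy2_inner g (X n))" for n
    proof -
      have XH: "X n \<in> hardy2" and TX: "?T (X n) \<in> hardy2" and NX: "hardy2_norm (X n) = 1"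
        by (simp_all only: X_def xH Tx nx)
      have "e\<^sup>2 \<le> (cmod (?\<theta> (s (r n))))\<^sup>2" using e se by (intro power_mono) auto
      also have "\<dots> \<le> cmod (hardy2_inner (?T (X n)) (X n))" unfolding X_def by (rule low)
      also have "hardy2_inner (?T (X n)) (X n)
          = hardy2_inner (\<lambda>z. ?T (X n) z - g z) (X n) + hardy2_inner g (X n)"
        using hardy2_inner_diff_left[OF TX g XH] by simp
      also have "cmod \<dots> \<le> cmod (hardy2_inner (\<lambda>z. ?T (X n) z - g z) (X n)) + cmod (hardy2_inner g (X n))"
        by (rule norm_triangle_ineq)
      also have "cmod (hardy2_inner (\<lambda>z. ?T (X n) z - g z) (X n)) \<le> hardy2_norm (\<lambda>z. ?T (X n) z - g z)"
        using hardy2_Cauchy_Schwarz[OF hardy2_diff[OF TX g] XH] by (simp only: NX mult_1_right)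
      finally show ?thesis by simp
    qed
    ultimately have "e\<^sup>2 \<le> 0 + 0"
      by (intro LIMSEQ_le_const) auto
    then show False using e by simp
  qed
  show "limit_set B \<subseteq> limit_set A"
  proof
    fix l assume "l \<in> limit_set B"
    then have l: "l \<in> closure B" "l \<notin> B" by (auto simp: limit_set_def)
    \<comment> \<open>Deleting finitely many points of \<open>B\<close> removes only a closed set
      that misses \<open>l\<close>, so \<open>l\<close> is still approached by points of arbitrarily
      large index.\<close>
    have near: "\<exists>j\<ge>J. dist (b j) l < d" if d: "d > 0" for d J
    proof -
      have "l \<in> closure (B - b ` {..<J})"
      proof -
        have "B \<subseteq> (B - b ` {..<J}) \<union> b ` {..<J}" by blast
        then have "closure B \<subseteq> closure (B - b ` {..<J}) \<union> b ` {..<J}"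
          by (metis closure_Un closure_mono finite_imageI finite_lessThan finite_imp_closed closure_closed)
        then show ?thesis using l bB by auto
      qed
      then obtain y where "y \<in> B - b ` {..<J}" "dist y l < d"
        using d closure_approachable by blast
      moreover then obtain j where "y = b j" using b by (auto simp: bij_betw_def)
      ultimately show ?thesis by (intro exI[of _ j]) (auto simp: not_less[symmetric])
    qed
    \<comment> \<open>Points of large index have modulus near one, and so does their limit; this
      keeps \<open>l\<close> out of \<open>A\<close>, which lies in the open disk.\<close>
    have "cmod l \<ge> 1"
    proof (rule field_le_epsilon)
      fix e :: real assume e: "e > 0"
      obtain J where J: "\<And>j. j \<ge> J \<Longrightarrow> \<bar>cmod (b j) - 1\<bar> < e/2"
        using LIMSEQ_D[OF b_lim, of "e/2"] e by auto
      obtain j where j: "j \<ge> J" "dist (b j) l < e/2" using near[of "e/2" J] e by auto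
      then show "1 \<le> cmod l + e"
        using J[OF j(1)] norm_triangle_ineq2[of "b j" l] unfolding dist_norm abs_less_iff by linarith
    qed
    then have "l \<notin> A" using A by (auto simp: blaschke_condition_def)
    moreover have "l \<in> closure A"
    proof (rule ccontr)
      assume "l \<notin> closure A"
      then obtain d where d: "d > 0" and far: "\<And>a. a \<in> A \<Longrightarrow> d \<le> dist a l"
        unfolding closure_approachable by (auto simp: not_less)
      \<comment> \<open>Points within \<open>d/2\<close> of \<open>l\<close> stay at distance at
        least \<open>d/2\<close> from \<open>A\<close>, so this single constant serves all of them
        in the Blaschke estimate.\<close>
      define C where "C = 2 * (\<Sum>\<^sub>\<infinity>a\<in>A. 1 - cmod a) / (d/2)\<^sup>2"
      \<comment> \<open>For points close to \<open>l\<close> the estimate makes this quantity at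
        least one, yet by the first conclusion it tends to zero.\<close>
      have "(\<lambda>j. (1 - (cmod (b j))\<^sup>2) * C + (cmod (?\<theta> j))\<^sup>2) \<longlonglongrightarrow> (1 - 1\<^sup>2) * C + (cmod 0)\<^sup>2"
        by (intro tendsto_intros b_lim lim0)
      then have "\<forall>\<^sub>F j in sequentially. (1 - (cmod (b j))\<^sup>2) * C + (cmod (?\<theta> j))\<^sup>2 < 1"
        by (intro order_tendstoD) auto
      then obtain J where J: "\<And>j. j \<ge> J \<Longrightarrow> (1 - (cmod (b j))\<^sup>2) * C + (cmod (?\<theta> j))\<^sup>2 < 1"
        unfolding eventually_sequentially by blast
      obtain j where j: "j \<ge> J" "dist (b j) l < d/2" using near[of "d/2" J] d by auto
      have "d/2 \<le> cmod (a - b j)" if "a \<in> A" for a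
        using far[OF that] j(2) dist_triangle[of a l "b j"] by (simp add: dist_norm)
      then have "1 - (cmod (?\<theta> j))\<^sup>2 \<le> (1 - (cmod (b j))\<^sup>2) * C"
        unfolding C_def using d by (intro one_minus_cmod_blaschke_product_sq[OF A b1]) auto
      then show False using J[OF j(1)] by simp
    qed
    ultimately show "l \<in> limit_set A" by (simp add: limit_set_def)
  qed
qed

end
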